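(* Let $p$, $q$ be distinct primes and let $r$ be a positive integer with $\gcd(r,pq)=1$. Let $n=q^b$ where $b$ is a positive integer. Suppose that $Y\overline{Y}=n$ for some $Y\in\mathbb{Z}[\zeta_{pr}]$. If $\mathrm{ord}_p(q)$ is even and $p>\max\{3^{n/2},\,n^2+n+1\}$, then $Y\eta\in\mathbb{Z}[\zeta_r]$ for some root of unity $\eta$.
   Context: For a positive integer $k$, $\zeta_k=\exp(2\pi i/k)\in\mathbb{C}$. $\overline{Y}$ is the complex conjugate of $Y$. $\mathrm{ord}_p(q)$ is the multiplicative order of $q$ modulo $p$. *)

theory Defs
  imports
    Complex_Main
    "HOL-Computational_Algebra.Polynomial"
    "HOL-Number_Theory.Pocklington"
begin

definition zeta :: "nat \<Rightarrow> complex" where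
  "zeta k = exp (2 * of_real pi * \<i> / of_nat k)"

definition int_adjoin :: "complex \<Rightarrow> complex set" where
  "int_adjoin z = {poly (map_poly of_int f) z | f :: int poly. True}"

definition root_of_unity :: "complex \<Rightarrow> bool" where
  "root_of_unity x \<longleftrightarrow> (\<exists>m > 0. x ^ m = 1)"

end

theory Submission
  imports Defs "Jordan_Normal_Form.Char_Poly"
begin

text \<open>
  Write \<open>\<zeta>\<^sub>p = zeta p\<close>. Expanding \<open>Y\<close> in powers of \<open>\<zeta>\<^sub>p\<close> with coefficients in
  \<open>\<int>[\<zeta>\<^sub>r]\<close>, Parseval over the conjugates fixing \<open>\<zeta>\<^sub>r\<close> and the arithmetic-geometric mean
  inequality for norms show that at most \<open>n\<close> coefficients are needed once \<open>p > n\<^sup>2 + n + 1\<close>.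
  A power of the Frobenius at \<open>q\<close> inverts \<open>\<zeta>\<^sub>p\<close> because \<open>ord\<^sub>p(q)\<close> is even. It fixes all
  ideals dividing a power of \<open>q\<close>, so it multiplies \<open>Y\<close> by some \<open>\<epsilon>\<close> with \<open>\<epsilon> * cnj \<epsilon> = 1\<close>; the case
  \<open>n = 1\<close> of the first step shows that \<open>\<epsilon>\<close> has a single term. Hence, up to a translation, the support
  \<open>S\<close> of \<open>Y\<close> modulo \<open>p\<close> is symmetric. As \<open>Y * cnj Y = n\<close> has only a constant term, no nonzero
  residue is represented exactly once as a difference of elements of \<open>S\<close>. But if \<open>S\<close> contains a
  nonzero element and \<open>p > 3 ^ (n / 2)\<close>, then some \<open>2 x\<close> is represented exactly once: otherwise every
  nonzero \<open>x \<in> S\<close> is the midpoint of two other elements, and the resulting linear system has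
  a determinant that is divisible by \<open>p\<close> and at most \<open>3 ^ (n / 2)\<close>. So \<open>S\<close> is a single point.
\<close>

section \<open>Evaluation and roots of integer polynomials\<close>

hide_const (open) Module.smult up_ring.monom up_ring.coeff

text \<open>The powers of \<open>zeta p\<close> sum to 0, so the coefficients of an element are
  determined only up to a common additive constant. Hence the estimates concern differences of
  coefficients, and a support has a meaning only when it is small compared with \<open>p\<close>.
  The exponent n / 2 counts unknowns: a symmetric support with at most n elements has at most n / 2
  positive ones. The base 3 is the delicate constant. A relation y + z = 2 x gives a row of total
  absolute weight 4, so row sums alone would bound the determinant by 4 ^ (n / 2). Passing to the
  permanent and splitting permutations into cycles saves this: a cycle is either fixed or moved as a
  whole, and the two weights together stay below 3 per row as soon as some row of the cycle has
  diagonal entry 2. Identifying x with -x also creates rows with diagonal entry 3, namely when y =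
  -x. A cycle of such rows alone would break the bound; it is excluded arithmetically, because it
  would make \<open>p\<close> divide 3^s + 1 or 3^s - 1. The double 2 x matters because, by
  symmetry, it is the difference x - (-x) of two elements of the support.\<close>

abbreviation ev :: "int poly \<Rightarrow> complex \<Rightarrow> complex" where
  "ev f x \<equiv> poly (map_poly of_int f) x"

lemma ev_add: "ev (f + g) x = ev f x + ev g x" by (simp add: of_int_poly_hom.hom_add)
lemma ev_diff: "ev (f - g) x = ev f x - ev g x" by (simp add: of_int_poly_hom.hom_minus)
lemma ev_mult: "ev (f * g) x = ev f x * ev g x" by (simp add: of_int_poly_hom.hom_mult)
lemma ev_power: "ev (f ^ k) x = ev f x ^ k" by (simp add: of_int_poly_hom.hom_power)
lemma ev_1: "ev 1 x = 1" by simp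
lemma ev_0: "ev 0 x = 0" by simp
lemma ev_smult: "ev (smult c f) x = of_int c * ev f x" by (simp add: of_int_hom.map_poly_hom_smult)
lemma ev_monom: "ev (monom c k) x = of_int c * x ^ k" by (simp add: map_poly_monom poly_monom)
lemma ev_const: "ev [:c:] x = of_int c" by (simp add: poly_altdef degree_map_poly)
lemma ev_of_nat: "ev (of_nat c) x = of_nat c" by (simp add: of_nat_poly ev_const)
lemma ev_of_int: "ev (of_int c) x = of_int c" by (simp add: of_int_poly ev_const)
lemma ev_pcompose: "ev (pcompose f g) x = ev f (ev g x)"
  by (simp add: of_int_hom.map_poly_pcompose poly_pcompose)
lemma ev_prod: "ev (prod f A) x = (\<Prod>a\<in>A. ev (f a) x)"
  by (simp add: of_int_poly_hom.hom_prod poly_prod)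
lemma ev_coeffs: "ev f x = (\<Sum>i\<le>degree f. of_int (coeff f i) * x ^ i)"
  by (simp add: poly_altdef)

section \<open>Congruences modulo a prime in the integer polynomials\<close>

lemma freshman_dvd:
  fixes a b :: "'a::comm_ring_1"
  assumes "prime q"
  shows "of_nat q dvd (a + b) ^ q - a ^ q - b ^ q"
proof -
  have q: "q > 0" using assms prime_gt_0_nat by blast
  have "(a + b) ^ q = (\<Sum>k\<le>q. of_nat (q choose k) * a ^ k * b ^ (q - k))"
    by (rule binomial_ring)
  also have "{..q} = insert 0 (insert q {0<..<q})" using q by auto
  also have "(\<Sum>k\<in>insert 0 (insert q {0<..<q}). of_nat (q choose k) * a ^ k * b ^ (q - k))
      = b ^ q + (a ^ q + (\<Sum>k\<in>{0<..<q}. of_nat (q choose k) * a ^ k * b ^ (q - k)))"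
    using q by simp
  finally have eq: "(a + b) ^ q - a ^ q - b ^ q = (\<Sum>k\<in>{0<..<q}. of_nat (q choose k) * a ^ k * b ^ (q - k))"
    by simp
  have "of_nat q dvd (of_nat (q choose k) :: 'a)" if "k \<in> {0<..<q}" for k
  proof -
    have "q dvd (q choose k)" using that assms by (intro dvd_choose_prime) auto
    then show ?thesis by (auto elim!: dvdE)
  qed
  then show ?thesis unfolding eq by (intro dvd_sum) (auto intro: dvd_mult2)
qed

lemma fermat_int_dvd:
  fixes a :: int
  assumes "prime q"
  shows "int q dvd a ^ q - a"
proof -
  have q: "q > 0" using assms prime_gt_0_nat by blast
  have nn: "int q dvd int n ^ q - int n" for n
  proof (induction n)
    case 0 then show ?case using q by (simp add: power_0_left)
  next
    case (Suc n)
    have "of_nat q dvd (int n + 1) ^ q - int n ^ q - 1 ^ q" by (rule freshman_dvd[OF assms])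
    with Suc have "int q dvd ((int n + 1) ^ q - int n ^ q - 1 ^ q) + (int n ^ q - int n)"
      by (intro dvd_add) auto
    then show ?case by (simp add: algebra_simps)
  qed
  have "[a ^ q = (a mod int q) ^ q] (mod int q)" by (simp add: cong_def power_mod)
  moreover have "[(a mod int q) ^ q = a mod int q] (mod int q)"
    using nn[of "nat (a mod int q)"] q by (simp add: cong_iff_dvd_diff)
  moreover have "[a mod int q = a] (mod int q)" by (simp add: cong_def)
  ultimately have "[a ^ q = a] (mod int q)" using cong_trans by blast
  then show ?thesis by (simp add: cong_iff_dvd_diff)
qed

text \<open>The identity f(x)^q = f(x^q) of characteristic q, kept as a divisibility in the integer
  polynomials so that it survives evaluation at complex numbers. The induction splits off the
  constant term, to which Fermat applies.\<close>

lemma frobenius_poly: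
  fixes f :: "int poly"
  assumes "prime q"
  shows "of_nat q dvd f ^ q - pcompose f (monom 1 q)"
proof (induction f)
  case 0
  then show ?case using prime_gt_0_nat[OF assms] by (simp add: power_0_left)
next
  case (pCons a f)
  have q: "q > 0" using assms prime_gt_0_nat by blast
  have e: "pCons a f = [:a:] + monom 1 1 * f" by (simp add: monom_altdef)
  have c: "pcompose (pCons a f) (monom 1 q) = [:a:] + monom 1 q * pcompose f (monom 1 q)"
    by (simp add: pcompose_pCons)
  have 1: "of_nat q dvd (pCons a f) ^ q - [:a:] ^ q - (monom 1 1 * f) ^ q"
    unfolding e by (rule freshman_dvd[OF assms])
  have 2: "(of_nat q :: int poly) dvd [:a:] ^ q - [:a:]"
  proof -
    obtain k where "a ^ q - a = int q * k" using fermat_int_dvd[OF assms, of a] by (auto elim: dvdE)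
    then have "[:a:] ^ q - [:a:] = of_nat q * [:k:]" by (simp add: of_nat_poly poly_const_pow)
    then show ?thesis by (metis dvd_triv_left)
  qed
  have 3: "of_nat q dvd monom 1 q * (f ^ q - pcompose f (monom 1 q))"
    using pCons.IH by (rule dvd_mult)
  have "(pCons a f) ^ q - pcompose (pCons a f) (monom 1 q) =
     ((pCons a f) ^ q - [:a:] ^ q - (monom 1 1 * f) ^ q) + ([:a:] ^ q - [:a:])
      + monom 1 q * (f ^ q - pcompose f (monom 1 q))"
    unfolding c by (simp add: power_mult_distrib monom_power algebra_simps)
  then show ?case using 1 2 3 by (metis dvd_add)
qed

text \<open>Gauss's lemma gives divisibility over the integers: a polynomial of least degree is made
  primitive, pseudo-division leaves \<open>smult c f = g * w\<close>, and multiplicativity of the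
  content forces \<open>c\<close> to divide \<open>w\<close>.\<close>

lemma minimal_int_poly:
  fixes \<alpha> :: complex
  assumes "f0 \<noteq> 0" "ev f0 \<alpha> = 0"
  obtains g where "g \<noteq> 0" "ev g \<alpha> = 0" "\<And>f. ev f \<alpha> = 0 \<Longrightarrow> g dvd f"
proof -
  define P where "P = (\<lambda>g::int poly. g \<noteq> 0 \<and> ev g \<alpha> = 0)"
  obtain g1 where g1: "P g1" and min: "\<And>h. P h \<Longrightarrow> degree g1 \<le> degree h"
    using exists_least_iff[of "\<lambda>d. \<exists>g. P g \<and> degree g = d"] assms
    by (metis P_def not_le)
  define g where "g = primitive_part g1"
  have sm: "g1 = smult (content g1) g" by (simp add: g_def)
  have g0: "g \<noteq> 0" using g1 P_def g_def by simp
  have "content g1 \<noteq> 0" using g1 P_def by simp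
  have eg: "ev g \<alpha> = 0" using g1 \<open>content g1 \<noteq> 0\<close> sm ev_smult[of "content g1" g \<alpha>] P_def by simp
  have dg: "degree g = degree g1" by (simp add: g_def)
  have cg: "content g = 1" using g1 unfolding g_def P_def by simp
  have "g dvd f" if "ev f \<alpha> = 0" for f
  proof -
    obtain w r where wr: "pseudo_divmod f g = (w, r)" by force
    define c where "c = lead_coeff g ^ (Suc (degree f) - degree g)"
    have c0: "c \<noteq> 0" using g0 c_def by simp
    have e: "smult c f = g * w + r" and r: "r = 0 \<or> degree r < degree g"
      using pseudo_divmod[OF g0 wr] c_def by auto
    have "ev r \<alpha> = 0"
      using arg_cong[OF e, of "\<lambda>h. ev h \<alpha>"] that eg by (simp add: ev_smult ev_add ev_mult)
    with r min dg have "r = 0" unfolding P_def by (metis not_le)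
    with e have e: "smult c f = g * w" by simp
    have "content w = normalize c * content f" using arg_cong[OF e, of content] cg by (simp add: content_mult)
    then have "c dvd content w" by simp
    then have "[:c:] dvd w" by (simp add: const_poly_dvd_iff_dvd_content)
    then obtain w' where "w = smult c w'" by (auto elim!: dvdE)
    with e c0 have "f = g * w'" by (metis mult_smult_right smult_cancel)
    then show ?thesis by simp
  qed
  with that g0 eg show ?thesis by blast
qed

text \<open>If \<open>x ^ N - 1 = g h\<close> then \<open>N = x (x ^ N - 1)' - N (x ^ N - 1)\<close> lies in the ideal
  generated by \<open>g\<close> and \<open>h\<close>, so \<open>g\<close> and \<open>h\<close> stay coprime modulo every prime \<open>q\<close> not dividing
  \<open>N\<close>; hence \<open>g\<close> cannot divide \<open>h(x ^ q)\<close>, which is \<open>h ^ q\<close> modulo \<open>q\<close>.\<close>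
lemma root_transfer_prime:
  fixes \<alpha> :: complex
  assumes N: "N > 0" "\<alpha> ^ N = 1" and q: "prime q" "\<not> q dvd N" and f: "ev f \<alpha> = 0"
  shows "ev f (\<alpha> ^ q) = 0"
proof -
  define \<Phi> where "\<Phi> = monom (1::int) N - 1"
  have evPhi: "ev \<Phi> x = x ^ N - 1" for x unfolding \<Phi>_def ev_diff ev_monom ev_1 by simp
  have dPhi: "degree \<Phi> = N"
    unfolding \<Phi>_def using N degree_add_eq_left[of "- 1" "monom (1::int) N"] by (simp add: degree_monom_eq)
  then have "\<Phi> \<noteq> 0" using N by force
  obtain g where g0: "g \<noteq> 0" and eg: "ev g \<alpha> = 0" and gdvd: "\<And>f. ev f \<alpha> = 0 \<Longrightarrow> g dvd f"
    using minimal_int_poly[OF \<open>\<Phi> \<noteq> 0\<close>, of \<alpha>] N evPhi by (metis diff_self)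
  obtain h where gh: "\<Phi> = g * h" using gdvd[of \<Phi>] N evPhi by (auto elim: dvdE)
  have "lead_coeff \<Phi> = 1"
  proof -
    have "coeff \<Phi> N = 1" unfolding \<Phi>_def using N by simp
    then show ?thesis using dPhi by simp
  qed
  then have "lead_coeff g * lead_coeff h = 1" by (simp add: gh lead_coeff_mult)
  then have lg: "lead_coeff g dvd 1" by (metis dvd_triv_left)
  have degg: "degree g > 0"
  proof (rule ccontr)
    assume "\<not> degree g > 0"
    then obtain c where "g = [:c:]" by (metis degree_eq_zeroE gr0I)
    then show False using eg g0 by simp
  qed
  have "ev h (\<alpha> ^ q) \<noteq> 0"
  proof
    assume "ev h (\<alpha> ^ q) = 0"
    then have "ev (pcompose h (monom 1 q)) \<alpha> = 0" unfolding ev_pcompose ev_monom by simp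
    then have g1: "g dvd pcompose h (monom 1 q)" by (rule gdvd)
    obtain u where u: "h ^ q - pcompose h (monom 1 q) = of_nat q * u"
      using frobenius_poly[OF q(1), of h] by (auto elim: dvdE)
    define R where "R = monom 1 1 * pderiv g"
    define P where "P = monom 1 1 * pderiv h - of_nat N * h"
    have pd: "monom 1 1 * pderiv \<Phi> = of_nat N * (\<Phi> + 1)"
    proof -
      have "pderiv \<Phi> = monom (int N) (N - 1)" by (simp add: \<Phi>_def pderiv_diff pderiv_monom)
      then show ?thesis using N unfolding \<Phi>_def
        by (simp add: mult_monom of_nat_poly smult_monom)
    qed
    have NN: "of_nat N = g * P + h * R"
    proof -
      have "of_nat N = monom 1 1 * pderiv \<Phi> - of_nat N * \<Phi>" using pd by (simp add: algebra_simps)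
      also have "\<dots> = g * P + h * R" unfolding gh pderiv_mult P_def R_def by (simp add: algebra_simps)
      finally show ?thesis .
    qed
    \<comment> \<open>\<open>N - h R\<close> is a multiple of \<open>g\<close>, hence so is the
      difference of the q-th powers. This brings in h^q, which may be traded for h(x^q) modulo
      \<open>q\<close>.\<close>
    have "g dvd (of_nat N) ^ q - (h * R) ^ q"
    proof -
      have "of_nat N - h * R dvd (of_nat N) ^ q - (h * R) ^ q"
        by (metis power_diff_sumr2 dvd_triv_left)
      moreover have "of_nat N - h * R = g * P" using NN by simp
      ultimately show ?thesis using dvd_trans[OF dvd_triv_left] by metis
    qed
    moreover have "(h * R) ^ q = pcompose h (monom 1 q) * R ^ q + of_nat q * (u * R ^ q)"
      using u by (simp add: power_mult_distrib algebra_simps)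
    moreover have "g dvd pcompose h (monom 1 q) * R ^ q" using g1 by (rule dvd_mult2)
    ultimately have "g dvd ((of_nat N) ^ q - (pcompose h (monom 1 q) * R ^ q + of_nat q * (u * R ^ q)))
        + pcompose h (monom 1 q) * R ^ q" by (metis dvd_add)
    then have "g dvd (of_nat N) ^ q - of_nat q * (u * R ^ q)" by simp
    then obtain v where v: "(of_nat N) ^ q - of_nat q * (u * R ^ q) = g * v" by (auto elim: dvdE)
    define U where "U = u * R ^ q"
    \<comment> \<open>The leading coefficient of \<open>g\<close> is a unit, so \<open>c\<close> is
      one too. With the remainder \<open>r\<close> in place of \<open>U\<close>, the multiple of
      \<open>g\<close> obtained below has smaller degree than \<open>g\<close> and must be 0. What
      remains is c N^q = q r, and constant terms give the contradiction.\<close>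
    obtain s r where sr: "pseudo_divmod U g = (s, r)" by force
    define c where "c = lead_coeff g ^ (Suc (degree U) - degree g)"
    have e: "smult c U = g * s + r" and r: "r = 0 \<or> degree r < degree g"
      using pseudo_divmod[OF g0 sr] c_def by auto
    have cu: "c dvd 1" unfolding c_def using lg by (metis dvd_power_same power_one)
    have "g * (smult c v + of_nat q * s) = smult c (of_nat N ^ q) - of_nat q * r"
    proof -
      have "g * smult c v = smult c (of_nat N ^ q) - of_nat q * smult c U"
        unfolding U_def using arg_cong[OF v, of "smult c"] by (simp add: smult_diff_right)
      then show ?thesis unfolding e by (simp add: algebra_simps)
    qed
    moreover have "degree (smult c (of_nat N ^ q) - of_nat q * r) < degree g"
    proof -
      have "degree (smult c (of_nat N ^ q)) = 0" using degree_smult_le[of c "of_nat N ^ q"] by (simp flip: of_nat_power)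
      moreover have "degree (of_nat q * r) < degree g" using r degg
        by (cases "r = 0") (auto simp: of_nat_poly intro: le_less_trans[OF degree_smult_le])
      ultimately show ?thesis using degg by (metis degree_diff_le_max max_less_iff_conj le_less_trans)
    qed
    ultimately have "smult c v + of_nat q * s = 0"
      using degree_mult_right_le[of "smult c v + of_nat q * s" g] g0
      by (cases "smult c v + of_nat q * s = 0") (auto simp: degree_mult_eq)
    then have "smult c (of_nat N ^ q) = of_nat q * r"
      using \<open>g * _ = _\<close> by simp
    then have "coeff (smult c (of_nat N ^ q)) 0 = coeff (of_nat q * r) 0" by simp
    then have "c * int N ^ q = int q * coeff r 0"
      by (simp add: of_nat_poly poly_const_pow)
    then have "int q dvd c * int N ^ q" by simp
    then have "int q dvd int N ^ q" using cu
      by (metis dvd_mult_unit_iff' is_unit_mult_iff mult.commute)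
    then have "q dvd N ^ q" by (metis of_nat_dvd_iff of_nat_power)
    then show False using q prime_dvd_power by blast
  qed
  moreover have "ev \<Phi> (\<alpha> ^ q) = 0" using N evPhi by (metis power_mult mult.commute power_one diff_self)
  ultimately have "ev g (\<alpha> ^ q) = 0" by (simp add: gh ev_mult)
  then show ?thesis using gdvd[OF f] by (auto elim!: dvdE simp: ev_mult)
qed

text \<open>The prime factors of \<open>k\<close> are treated one at a time. The root is generalised
  in the induction, because a step along \<open>q\<close> replaces it by its q-th power. The value k
  = 0 is coprime to \<open>N\<close> only for N = 1.\<close>

lemma root_transfer:
  fixes \<alpha> :: complex
  assumes "N > 0" "\<alpha> ^ N = 1" "coprime k N" "ev f \<alpha> = 0"
  shows "ev f (\<alpha> ^ k) = 0"
  using assms(2-4)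
proof (induction k arbitrary: \<alpha> rule: less_induct)
  case (less k)
  consider "k = 0" | "k = 1" | "k > 1" by linarith
  then show ?case
  proof cases
    case 1
    then have "N = 1" using less by simp
    then show ?thesis using less 1 by simp
  next
    case 2 then show ?thesis using less by simp
  next
    case 3
    then obtain q where q: "prime q" "q dvd k" using prime_factor_nat[of k] 3 by auto
    obtain k' where k': "k = q * k'" using q(2) by (rule dvdE)
    have "k' > 0" using k' 3 by (cases k') auto
    then have "k' < k" using k' prime_gt_1_nat[OF q(1)] by simp
    have "\<not> q dvd N" using less.prems(2) q coprime_common_divisor[of k N q] not_prime_unit by blast
    then have 1: "ev f (\<alpha> ^ q) = 0" using root_transfer_prime[OF assms(1) less.prems(1) q(1) _ less.prems(3)] by blast
    have "(\<alpha> ^ q) ^ N = 1" using less.prems(1) by (simp add: power_mult[symmetric] mult.commute[of q]) (simp add: power_mult)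
    moreover have "coprime k' N" using less.prems(2) k' by simp
    ultimately have "ev f ((\<alpha> ^ q) ^ k') = 0" using less.IH[OF \<open>k' < k\<close>] 1 by blast
    then show ?thesis by (simp add: k' power_mult)
  qed
qed

section \<open>Conjugates and norms in cyclotomic rings\<close>

lemma int_adjoin_iff: "x \<in> int_adjoin z \<longleftrightarrow> (\<exists>f. x = ev f z)"
  by (auto simp: int_adjoin_def)

lemma ev_in_int_adjoin [simp]: "ev f z \<in> int_adjoin z"
  by (auto simp: int_adjoin_iff)

lemma int_adjoinE:
  assumes "x \<in> int_adjoin z"
  obtains f where "x = ev f z"
  using assms by (auto simp: int_adjoin_iff)

lemma int_adjoin_add: "x \<in> int_adjoin z \<Longrightarrow> y \<in> int_adjoin z \<Longrightarrow> x + y \<in> int_adjoin z"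
  unfolding int_adjoin_iff using ev_add by metis

lemma int_adjoin_diff: "x \<in> int_adjoin z \<Longrightarrow> y \<in> int_adjoin z \<Longrightarrow> x - y \<in> int_adjoin z"
  unfolding int_adjoin_iff using ev_diff by metis

lemma int_adjoin_mult: "x \<in> int_adjoin z \<Longrightarrow> y \<in> int_adjoin z \<Longrightarrow> x * y \<in> int_adjoin z"
  unfolding int_adjoin_iff using ev_mult by metis

lemma int_adjoin_of_int: "of_int c \<in> int_adjoin z"
  unfolding int_adjoin_iff using ev_of_int by metis

lemma int_adjoin_0: "0 \<in> int_adjoin z"
  using int_adjoin_of_int[of 0] by simp

lemma int_adjoin_power_gen: "z ^ k \<in> int_adjoin z"
  unfolding int_adjoin_iff by (rule exI[of _ "monom 1 k"], unfold ev_monom) simp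

lemma int_adjoin_power_subset: "x \<in> int_adjoin (z ^ k) \<Longrightarrow> x \<in> int_adjoin z"
  by (elim int_adjoinE) (metis ev_in_int_adjoin ev_monom ev_pcompose mult_1 of_int_1)

lemma int_adjoin_sum:
  "(\<And>a. a \<in> A \<Longrightarrow> f a \<in> int_adjoin z) \<Longrightarrow> sum f A \<in> int_adjoin z"
  by (induction A rule: infinite_finite_induct) (auto intro: int_adjoin_0 int_adjoin_add)

section \<open>Powers of \<open>zeta N\<close> and complex conjugation\<close>

lemma zeta_cis: "zeta N = cis (2 * pi / N)"
  by (simp add: zeta_def cis_conv_exp mult_ac)

lemma zeta_power_cis: "zeta N ^ k = cis (2 * pi * k / N)"
  by (simp add: zeta_cis DeMoivre mult_ac)

lemma zeta_power_self: "N > 0 \<Longrightarrow> zeta N ^ N = 1"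
  by (simp add: zeta_power_cis)

lemma zeta_power_mod: "N > 0 \<Longrightarrow> zeta N ^ (k mod N) = zeta N ^ k"
  by (metis div_mult_mod_eq mult.commute mult_1 power_add power_mult power_one zeta_power_self)

lemma zeta_power_cong: "N > 0 \<Longrightarrow> [k = l] (mod N) \<Longrightarrow> zeta N ^ k = zeta N ^ l"
  by (metis cong_def zeta_power_mod)

lemma zeta_power_eq_1_iff:
  assumes "N > 0"
  shows "zeta N ^ k = 1 \<longleftrightarrow> N dvd k"
proof
  assume "zeta N ^ k = 1"
  then have eq: "zeta N ^ (k mod N) = zeta N ^ 0" by (simp add: zeta_power_mod assms)
  have "inj_on (\<lambda>k. cis (2 * pi * real k / real N)) {..<N}"
    using bij_betw_roots_unity[OF assms] by (auto simp: bij_betw_def)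
  then have "k mod N = 0" using eq assms unfolding zeta_power_cis
    by (metis inj_onD lessThan_iff mod_less_divisor)
  then show "N dvd k" by auto
next
  assume "N dvd k"
  then show "zeta N ^ k = 1" using assms by (auto elim!: dvdE simp: power_mult zeta_power_self)
qed

lemma zeta_nonzero [simp]: "zeta N \<noteq> 0"
  by (simp add: zeta_def)

lemma norm_zeta [simp]: "norm (zeta N) = 1"
  by (simp add: zeta_cis)

lemma zeta_mult_power: "d > 0 \<Longrightarrow> zeta (d * r) ^ d = zeta r"
  unfolding zeta_power_cis unfolding zeta_cis by simp

lemma zeta_mult_cnj: "zeta N ^ k * cnj (zeta N ^ k) = 1"
  using complex_norm_square[of "zeta N ^ k"] by (simp add: norm_power)

lemma cnj_zeta_power:
  assumes "N > 0" "[k + l = 0] (mod N)"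
  shows "cnj (zeta N ^ k) = zeta N ^ l"
proof -
  have "zeta N ^ k * zeta N ^ l = 1"
    using zeta_power_cong[OF assms] by (simp add: power_add)
  then show ?thesis using zeta_mult_cnj[of N k]
    by (metis mult_left_cancel power_not_zero zeta_nonzero)
qed

lemma cnj_ev: "cnj (ev f z) = ev f (cnj z)"
  by (simp add: ev_coeffs)

lemma cnj_zeta_pred: "N > 0 \<Longrightarrow> cnj (zeta N ^ k) = (zeta N ^ k) ^ (N - 1)"
proof -
  assume N: "N > 0"
  then have "k + k * (N - 1) = k * N" by (cases N) auto
  then have "[k + k * (N - 1) = 0] (mod N)" by (simp add: cong_def)
  from cnj_zeta_power[OF N this] show ?thesis by (simp add: power_mult)
qed

lemma int_adjoin_cnj:
  assumes "N > 0" "x \<in> int_adjoin (zeta N)"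
  shows "cnj x \<in> int_adjoin (zeta N)"
proof -
  obtain f where "x = ev f (zeta N)" using assms(2) by (rule int_adjoinE)
  then have "cnj x = ev f (zeta N ^ (N - 1))"
    using cnj_zeta_pred[OF assms(1), of 1] by (simp add: cnj_ev)
  then show ?thesis by (metis int_adjoin_power_subset ev_in_int_adjoin)
qed

text \<open>The value does not depend on the choice of \<open>f\<close> when \<open>k\<close> is coprime to \<open>N\<close>, by
  \<open>root_transfer\<close>; otherwise it is junk.\<close>
definition gal :: "nat \<Rightarrow> nat \<Rightarrow> complex \<Rightarrow> complex" where
  "gal N k x = ev (SOME f. x = ev f (zeta N)) (zeta N ^ k)"

lemma gal_ev:
  assumes "N > 0" "coprime k N"
  shows "gal N k (ev f (zeta N)) = ev f (zeta N ^ k)"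
proof -
  define g where "g = (SOME g. ev f (zeta N) = ev g (zeta N))"
  have "ev f (zeta N) = ev g (zeta N)"
    unfolding g_def by (rule someI) (rule refl)
  then have "ev (f - g) (zeta N) = 0" by (simp add: ev_diff)
  then have "ev (f - g) (zeta N ^ k) = 0"
    using root_transfer[of N "zeta N" k] assms zeta_power_self by blast
  then show ?thesis by (simp add: gal_def g_def ev_diff)
qed

context
  fixes N k :: nat
  assumes N: "N > 0" and k: "coprime k N"
begin

lemma gal_in_int_adjoin:
  assumes "x \<in> int_adjoin (zeta N)"
  shows "gal N k x \<in> int_adjoin (zeta N)"
  using assms by (elim int_adjoinE) (metis gal_ev[OF N k] int_adjoin_power_subset ev_in_int_adjoin)

lemma gal_add:
  assumes "x \<in> int_adjoin (zeta N)" "y \<in> int_adjoin (zeta N)"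
  shows "gal N k (x + y) = gal N k x + gal N k y"
  using assms by (elim int_adjoinE) (simp only: ev_add[symmetric] gal_ev[OF N k])

lemma gal_mult:
  assumes "x \<in> int_adjoin (zeta N)" "y \<in> int_adjoin (zeta N)"
  shows "gal N k (x * y) = gal N k x * gal N k y"
  using assms by (elim int_adjoinE) (simp only: ev_mult[symmetric] gal_ev[OF N k])

lemma gal_of_int: "gal N k (of_int c) = of_int c"
  using gal_ev[OF N k, of "of_int c"] unfolding ev_of_int .

lemma gal_0: "gal N k 0 = 0" and gal_1: "gal N k 1 = 1" and gal_of_nat: "gal N k (of_nat m) = of_nat m"
  using gal_of_int[of 0] gal_of_int[of 1] gal_of_int[of "int m"] by auto

lemma gal_zeta_power: "gal N k (zeta N ^ j) = zeta N ^ (k * j)"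
  using gal_ev[OF N k, of "monom 1 j"] unfolding ev_monom by (simp add: power_mult)

lemma gal_sum:
  assumes "\<And>a. a \<in> A \<Longrightarrow> f a \<in> int_adjoin (zeta N)"
  shows "gal N k (sum f A) = (\<Sum>a\<in>A. gal N k (f a))"
  using assms
  by (induction A rule: infinite_finite_induct) (simp_all add: gal_0 gal_add int_adjoin_sum)

text \<open>On polynomials in \<open>zeta N\<close>, complex conjugation is the substitution of the
  power with exponent N - 1, and two substitutions of powers commute.\<close>

lemma gal_cnj:
  assumes "x \<in> int_adjoin (zeta N)"
  shows "gal N k (cnj x) = cnj (gal N k x)"
proof -
  obtain f where f: "x = ev f (zeta N)" using assms by (rule int_adjoinE)
  have "cnj x = ev f (zeta N ^ (N - 1))"
    using cnj_zeta_pred[OF N, of 1] by (simp add: f cnj_ev)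
  also have "\<dots> = ev (pcompose f (monom 1 (N - 1))) (zeta N)" by (unfold ev_pcompose ev_monom) simp
  finally have "gal N k (cnj x) = ev f ((zeta N ^ k) ^ (N - 1))"
    by (simp only: gal_ev[OF N k]) (unfold ev_pcompose ev_monom, simp)
  also have "\<dots> = cnj (gal N k x)"
    using cnj_zeta_pred[OF N, of k] by (simp add: f gal_ev[OF N k] cnj_ev)
  finally show ?thesis .
qed

text \<open>The conjugation can be undone: with \<open>l\<close> inverse to \<open>k\<close> modulo
  \<open>N\<close>, root transfer leads from \<open>zeta N ^ k\<close> back to
  \<open>zeta N\<close>.\<close>

lemma gal_eq_0_iff:
  assumes "x \<in> int_adjoin (zeta N)"
  shows "gal N k x = 0 \<longleftrightarrow> x = 0"
proof
  assume g: "gal N k x = 0"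
  obtain f where f: "x = ev f (zeta N)" using assms by (rule int_adjoinE)
  obtain l where l: "[k * l = 1] (mod N)" using cong_solve_coprime_nat[OF k] by auto
  then have "coprime l N" by (metis cong_imp_coprime coprime_1_left coprime_mult_left_iff cong_sym)
  moreover have "(zeta N ^ k) ^ N = 1"
    by (metis power_mult mult.commute power_one zeta_power_self N)
  ultimately have "ev f ((zeta N ^ k) ^ l) = 0"
    using g root_transfer[of N "zeta N ^ k" l f] N by (simp add: f gal_ev[OF N k])
  moreover have "(zeta N ^ k) ^ l = zeta N"
    using zeta_power_cong[OF N l] by (simp add: power_mult)
  ultimately show "x = 0" by (simp add: f)
qed (simp add: gal_0)

lemma gal_tower:
  assumes "N = d * r" "x \<in> int_adjoin (zeta r)"
  shows "gal N k x = gal r k x"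
proof -
  have d: "d > 0" and r: "r > 0" "coprime k r" using assms(1) N k by auto
  obtain f where f: "x = ev f (zeta r)" using assms(2) by (rule int_adjoinE)
  also have "\<dots> = ev (pcompose f (monom 1 d)) (zeta N)"
    by (unfold ev_pcompose ev_monom) (simp add: zeta_mult_power d assms(1))
  finally have "gal N k x = ev f ((zeta N ^ k) ^ d)"
    by (simp only: gal_ev[OF N k]) (unfold ev_pcompose ev_monom, simp)
  also have "(zeta N ^ k) ^ d = zeta r ^ k"
    by (metis power_mult mult.commute zeta_mult_power d assms(1))
  finally show ?thesis by (simp add: f gal_ev[OF r])
qed

end

lemma gal_cong_1:
  assumes "N > 0" "coprime k N" "[k = 1] (mod N)" "x \<in> int_adjoin (zeta N)"
  shows "gal N k x = x"
  using assms(4) zeta_power_cong[OF assms(1,3)]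
  by (elim int_adjoinE) (simp add: gal_ev assms)

text \<open>\<open>units_below 1 = {0}\<close>, unlike \<open>totatives 1\<close>, so that the set is closed under multiplication
  modulo \<open>N\<close>.\<close>
definition units_below :: "nat \<Rightarrow> nat set" where
  "units_below N = {k. k < N \<and> coprime k N}"

lemma finite_units_below [simp]: "finite (units_below N)"
  by (simp add: units_below_def)

lemma units_below_nonempty:
  assumes "N > 0"
  shows "card (units_below N) > 0"
proof -
  have "1 mod N \<in> units_below N" using assms by (simp add: units_below_def coprime_commute)
  then show ?thesis using card_gt_0_iff finite_units_below by blast
qed

section \<open>Integrality of traces and lower bounds for norms\<close>

lemma sum_zeta_powers:
  assumes "N > 0"
  shows "(\<Sum>k<N. zeta N ^ (k * j)) = (if N dvd j then of_nat N else 0)"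
proof (cases "N dvd j")
  case True
  then have "zeta N ^ (k * j) = 1" for k using zeta_power_eq_1_iff assms by simp
  then show ?thesis using True by simp
next
  case False
  then have "zeta N ^ j \<noteq> 1" using zeta_power_eq_1_iff assms by simp
  have "(\<Sum>k<N. zeta N ^ (k * j)) = (\<Sum>k<N. (zeta N ^ j) ^ k)"
    by (simp add: power_mult[symmetric] mult.commute)
  also have "\<dots> = ((zeta N ^ j) ^ N - 1) / (zeta N ^ j - 1)"
    using \<open>zeta N ^ j \<noteq> 1\<close> by (rule geometric_sum)
  also have "(zeta N ^ j) ^ N = 1"
    by (metis power_mult mult.commute power_one zeta_power_self assms)
  finally show ?thesis using False by simp
qed

text \<open>Each k below \<open>N\<close> is m d with d = gcd(k, N) and m prime to N / d. The value
  k = 0 belongs to d = N, where \<open>units_below 1 = {0}\<close> supplies m = 0.\<close>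

lemma sum_by_gcd:
  fixes g :: "nat \<Rightarrow> 'a::comm_monoid_add"
  assumes "N > 0"
  shows "(\<Sum>k<N. g k) = (\<Sum>d | d dvd N. \<Sum>m\<in>units_below (N div d). g (m * d))"
proof -
  have "(\<Sum>d | d dvd N. \<Sum>m\<in>units_below (N div d). g (m * d)) =
    (\<Sum>(d, m)\<in>(SIGMA d:{d. d dvd N}. units_below (N div d)). g (m * d))"
    using assms by (intro sum.Sigma) auto
  also have "\<dots> = (\<Sum>k<N. g k)"
  proof (rule sum.reindex_bij_witness[where i = "\<lambda>k. (gcd k N, k div gcd k N)" and j = "\<lambda>(d, m). m * d"])
    fix a assume "a \<in> (SIGMA d:{d. d dvd N}. units_below (N div d))"
    then obtain d m where a: "a = (d, m)" "d dvd N" "m < N div d" "coprime m (N div d)"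
      by (auto simp: units_below_def)
    have d: "d > 0" using a(2) assms by (metis dvd_0_left gr0I not_gr0)
    obtain e where e: "N = d * e" using a(2) by (rule dvdE)
    have ge: "gcd (m * d) N = d"
      using a(4) d by (simp add: e gcd_mult_distrib_nat[symmetric] mult.commute[of m] coprime_iff_gcd_eq_1)
    show "(case a of (d, m) \<Rightarrow> m * d) \<in> {..<N}" using a d e by (simp add: mult.commute)
    show "(gcd (case a of (d, m) \<Rightarrow> m * d) N, (case a of (d, m) \<Rightarrow> m * d) div gcd (case a of (d, m) \<Rightarrow> m * d) N) = a"
      using a d ge by simp
    show "g (case a of (d, m) \<Rightarrow> m * d) = (case a of (d, m) \<Rightarrow> g (m * d))" using a by simp
  next
    fix k assume k: "k \<in> {..<N}"
    then show "(case (gcd k N, k div gcd k N) of (d, m) \<Rightarrow> m * d) = k" by simp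
    have "coprime (k div gcd k N) (N div gcd k N)"
      using assms by (intro div_gcd_coprime) auto
    moreover have "k div gcd k N < N div gcd k N"
      using k assms by (metis dvd_div_mult_self gcd_dvd1 gcd_dvd2 lessThan_iff mult_less_cancel2)
    ultimately show "(gcd k N, k div gcd k N) \<in> (SIGMA d:{d. d dvd N}. units_below (N div d))"
      by (simp add: units_below_def)
  qed
  finally show ?thesis by simp
qed

text \<open>These are the Ramanujan sums. The sum over all k below \<open>N\<close> is 0 or
  \<open>N\<close>, and sorting it by gcd expresses the sum for \<open>N\<close> through those for
  the proper divisors of \<open>N\<close>.\<close>

lemma ramanujan_sum_int: "N > 0 \<Longrightarrow> (\<Sum>k\<in>units_below N. zeta N ^ (k * j)) \<in> \<int>"
proof (induction N rule: less_induct)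
  case (less N)
  have fin: "finite {d. d dvd N}" using less.prems by simp
  have tower: "zeta N ^ (m * d * j) = zeta (N div d) ^ (m * j)" if "d dvd N" for m d
  proof -
    have "d > 0" using that less.prems by (metis dvd_0_left gr0I)
    moreover have "N = d * (N div d)" using that by simp
    ultimately have "zeta N ^ d = zeta (N div d)" by (metis zeta_mult_power)
    then show ?thesis by (metis power_mult mult.commute mult.left_commute)
  qed
  have "(\<Sum>k<N. zeta N ^ (k * j)) =
      (\<Sum>d | d dvd N. \<Sum>m\<in>units_below (N div d). zeta N ^ (m * d * j))"
    by (rule sum_by_gcd[OF less.prems])
  also have "\<dots> = (\<Sum>d | d dvd N. \<Sum>m\<in>units_below (N div d). zeta (N div d) ^ (m * j))"
    by (intro sum.cong refl tower) auto
  also have "\<dots> = (\<Sum>m\<in>units_below N. zeta N ^ (m * j)) +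
      (\<Sum>d\<in>{d. d dvd N} - {1}. \<Sum>m\<in>units_below (N div d). zeta (N div d) ^ (m * j))"
    by (subst sum.remove[OF fin, of 1]) auto
  finally have "(\<Sum>m\<in>units_below N. zeta N ^ (m * j)) = (\<Sum>k<N. zeta N ^ (k * j)) -
      (\<Sum>d\<in>{d. d dvd N} - {1}. \<Sum>m\<in>units_below (N div d). zeta (N div d) ^ (m * j))"
    by simp
  moreover have "(\<Sum>k<N. zeta N ^ (k * j)) \<in> \<int>"
    using less.prems by (simp add: sum_zeta_powers)
  moreover have "(\<Sum>d\<in>{d. d dvd N} - {1}. \<Sum>m\<in>units_below (N div d). zeta (N div d) ^ (m * j)) \<in> \<int>"
  proof (rule Ints_sum, rule less.IH)
    fix d assume that: "d \<in> {d. d dvd N} - {1}"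
    have "d > 0" "d \<noteq> 1" using that less.prems by (auto intro: gr0I)
    then show "N div d < N" using less.prems by (intro div_less_dividend) auto
    show "N div d > 0" using that less.prems by (auto simp: dvd_imp_le div_greater_zero_iff \<open>d > 0\<close>)
  qed
  ultimately show ?case by (simp only: Ints_diff Ints_sum)
qed

text \<open>The trace is an integer combination of Ramanujan sums.\<close>

lemma trace_int:
  assumes "N > 0"
  shows "(\<Sum>k\<in>units_below N. ev f (zeta N ^ k)) \<in> \<int>"
proof -
  have "(\<Sum>k\<in>units_below N. ev f (zeta N ^ k)) =
     (\<Sum>k\<in>units_below N. \<Sum>i\<le>degree f. of_int (coeff f i) * zeta N ^ (k * i))"
    by (simp add: ev_coeffs power_mult)
  also have "\<dots> = (\<Sum>i\<le>degree f. of_int (coeff f i) * (\<Sum>k\<in>units_below N. zeta N ^ (k * i)))"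
    by (subst sum.swap) (simp add: sum_distrib_left)
  finally show ?thesis using ramanujan_sum_int[OF assms] by (simp add: Ints_mult Ints_sum)
qed

lemma units_below_mult_bij:
  assumes "l \<in> units_below N"
  shows "bij_betw (\<lambda>k. l * k mod N) (units_below N) (units_below N)"
proof -
  have "inj_on (\<lambda>k. l * k mod N) (units_below N)"
  proof (rule inj_onI)
    fix x y assume "x \<in> units_below N" "y \<in> units_below N" and eq: "l * x mod N = l * y mod N"
    then have "x < N" "y < N" by (auto simp: units_below_def)
    moreover have "[x = y] (mod N)" using eq assms
      by (simp add: units_below_def flip: cong_def) (metis cong_mult_lcancel_nat)
    ultimately show "x = y" by (simp add: cong_def)
  qed
  moreover have "(\<lambda>k. l * k mod N) ` units_below N \<subseteq> units_below N"
    using assms by (auto simp: units_below_def)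
  ultimately show ?thesis by (simp add: bij_betw_def endo_inj_surj)
qed

text \<open>The norm \<open>v\<close> of a nonzero element is fixed by all conjugations, so the trace of \<open>v ^ m\<close> is
  \<open>card (units_below N) * v ^ m\<close>, a nonzero integer for every \<open>m\<close>. This is impossible
  if \<open>v\<close> is smaller than 1 in absolute value.\<close>
lemma norm_prod_ge_1:
  assumes N: "N > 0" and f: "ev f (zeta N) \<noteq> 0"
  shows "(\<Prod>k\<in>units_below N. norm (ev f (zeta N ^ k))) \<ge> 1"
proof (rule ccontr)
  define v where "v = (\<Prod>k\<in>units_below N. ev f (zeta N ^ k))"
  define c where "c = real (card (units_below N))"
  have c: "c > 0" using units_below_nonempty[OF N] by (simp add: c_def)
  assume "\<not> (\<Prod>k\<in>units_below N. norm (ev f (zeta N ^ k))) \<ge> 1"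
  then have v1: "norm v < 1" by (simp add: v_def prod_norm)
  have v0: "v \<noteq> 0"
  proof -
    have "ev f (zeta N ^ k) \<noteq> 0" if "k \<in> units_below N" for k
    proof -
      have k: "coprime k N" using that by (simp add: units_below_def)
      show ?thesis using gal_eq_0_iff[OF N k, of "ev f (zeta N)"] f by (simp add: gal_ev[OF N k])
    qed
    then show ?thesis by (simp add: v_def)
  qed
  obtain m where m: "norm v ^ m < 1 / c" using real_arch_pow_inv[OF _ v1, of "1 / c"] c by auto
  define F where "F = (\<Prod>k\<in>units_below N. pcompose f (monom 1 k)) ^ m"
  have "ev F (zeta N ^ l) = v ^ m" if l: "l \<in> units_below N" for l
  proof -
    have "ev F (zeta N ^ l) = (\<Prod>k\<in>units_below N. ev f (zeta N ^ (l * k mod N))) ^ m"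
      by (simp add: F_def ev_power ev_prod zeta_power_mod N power_mult)
         (unfold ev_pcompose ev_monom, simp)
    also have "(\<Prod>k\<in>units_below N. ev f (zeta N ^ (l * k mod N))) = v"
      unfolding v_def using units_below_mult_bij[OF l] by (rule prod.reindex_bij_betw)
    finally show ?thesis .
  qed
  then have "(\<Sum>l\<in>units_below N. ev F (zeta N ^ l)) = of_real c * v ^ m" by (simp add: c_def)
  then have "of_real c * v ^ m \<in> \<int>" using trace_int[OF N, of F] by simp
  then obtain z where z: "of_real c * v ^ m = of_int z" by (auto elim: Ints_cases)
  moreover have "of_real c * v ^ m \<noteq> 0" using c v0 by simp
  ultimately have "z \<noteq> 0" by auto
  then have "1 \<le> norm (of_real c * v ^ m)" using z by simp
  also have "\<dots> = c * norm v ^ m" using c by (simp add: norm_mult norm_power)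
  also have "\<dots> < 1" using m c by (simp add: field_simps)
  finally show False by simp
qed

text \<open>The arithmetic-geometric mean inequality in the form ln x <= x - 1: the logarithms of
  the squared conjugates have a nonnegative sum because the norm is at least 1 in absolute
  value.\<close>

lemma sum_norm_gal_ge:
  assumes N: "N > 0" and x: "x \<in> int_adjoin (zeta N)" "x \<noteq> 0"
  shows "(\<Sum>k\<in>units_below N. (norm (gal N k x))\<^sup>2) \<ge> card (units_below N)"
proof -
  obtain f where f: "x = ev f (zeta N)" using x(1) by (rule int_adjoinE)
  have g: "gal N k x = ev f (zeta N ^ k)" "gal N k x \<noteq> 0" if "k \<in> units_below N" for k
  proof -
    have k: "coprime k N" using that by (simp add: units_below_def)
    show "gal N k x = ev f (zeta N ^ k)" by (simp add: f gal_ev[OF N k])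
    show "gal N k x \<noteq> 0" using gal_eq_0_iff[OF N k x(1)] x(2) by simp
  qed
  have "0 \<le> ln (\<Prod>k\<in>units_below N. (norm (gal N k x))\<^sup>2)"
  proof (rule ln_ge_zero)
    have "1 \<le> (\<Prod>k\<in>units_below N. norm (gal N k x))"
      using norm_prod_ge_1[OF N, of f] x g by (simp add: f)
    then show "1 \<le> (\<Prod>k\<in>units_below N. (norm (gal N k x))\<^sup>2)"
      by (simp add: prod_power_distrib[symmetric] one_le_power)
  qed
  also have "\<dots> = (\<Sum>k\<in>units_below N. ln ((norm (gal N k x))\<^sup>2))"
    using g by (intro ln_prod) auto
  also have "\<dots> \<le> (\<Sum>k\<in>units_below N. (norm (gal N k x))\<^sup>2 - 1)"
    using g by (intro sum_mono ln_le_minus_one) auto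
  finally show ?thesis by (simp add: sum_subtractf)
qed

section \<open>Ideals stable under Frobenius\<close>

lemma frobenius_poly_power:
  fixes f :: "int poly"
  assumes "prime q"
  shows "of_nat q dvd f ^ (q ^ j) - pcompose f (monom 1 (q ^ j))"
proof (induction j)
  case 0
  then show ?case by (simp add: monom_altdef pcompose_idR)
next
  case (Suc j)
  define g where "g = pcompose f (monom 1 (q ^ j))"
  have "f ^ (q ^ j) - g dvd (f ^ (q ^ j)) ^ q - g ^ q"
    by (metis power_diff_sumr2 dvd_triv_left)
  with Suc have "of_nat q dvd (f ^ (q ^ j)) ^ q - g ^ q"
    unfolding g_def using dvd_trans by blast
  moreover have "of_nat q dvd g ^ q - pcompose g (monom 1 q)"
    by (rule frobenius_poly[OF assms])
  ultimately have "of_nat q dvd ((f ^ (q ^ j)) ^ q - g ^ q) + (g ^ q - pcompose g (monom 1 q))"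
    by (rule dvd_add)
  moreover have "pcompose g (monom 1 q) = pcompose f (monom 1 (q ^ Suc j))"
    by (simp add: g_def pcompose_assoc[symmetric] monom_altdef pcompose_pCons pcompose_hom.hom_power
        power_mult[symmetric] mult.commute)
  ultimately show ?case by (simp add: power_mult[symmetric] mult.commute)
qed

text \<open>For \<open>w \<in> I\<close> the element \<open>E = w ^ ((Q - 1) * q ^ b)\<close> is idempotent modulo \<open>q ^ Suc b\<close> and
  satisfies \<open>E * w = w\<close> modulo \<open>q\<close>. Hence \<open>s E\<close> is congruent to \<open>E\<close> modulo \<open>q ^ Suc b\<close>, and
  \<open>w - E * w = q * w1\<close> with \<open>w1\<close> in the colon ideal \<open>I : q\<close>, to which induction applies.\<close>
lemma frobenius_stable_ideal:
  fixes s :: "'a::comm_ring_1 \<Rightarrow> 'a" and q Q :: nat and K :: "'a set"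
  assumes q: "q > 0" and Q: "Q \<ge> 2"
    and s_add: "\<And>x y. s (x + y) = s x + s y" and s_mult: "\<And>x y. s (x * y) = s x * s y"
    and s_power: "\<And>x k. s (x ^ k) = s x ^ k" and s_q: "s (of_nat q) = of_nat q"
    and frob: "\<And>x. of_nat q dvd s x - x ^ q"
    and K_add: "\<And>x y. x \<in> K \<Longrightarrow> y \<in> K \<Longrightarrow> x + y \<in> K"
    and K_mult: "\<And>x y. x \<in> K \<Longrightarrow> y * x \<in> K"
    and s_K: "\<And>x. x \<in> K \<Longrightarrow> s x \<in> K"
    and per: "\<And>x. \<exists>u. x ^ Q - x - of_nat q * u \<in> K"
    and I: "\<And>x y. x \<in> I \<Longrightarrow> y \<in> I \<Longrightarrow> x + y \<in> I" "\<And>x y. x \<in> I \<Longrightarrow> y * x \<in> I"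
      "K \<subseteq> I" "of_nat q ^ b \<in> I"
    and w: "w \<in> I"
  shows "s w \<in> I"
  using I w
proof (induction b arbitrary: I w)
  case 0
  then show ?case by (metis mult.right_neutral power_0)
next
  case (Suc b)
  note I_add = Suc.prems(1) and I_mult = Suc.prems(2) and KI = Suc.prems(3)
  \<comment> \<open>\<open>C k\<close> is congruence modulo the ideal generated by q^k and
    \<open>K\<close>; in the application \<open>K\<close> is the kernel of evaluation at a root of
    unity.\<close>
  define C where "C = (\<lambda>k x y. \<exists>u. x - y - of_nat q ^ k * u \<in> K)"
  obtain x0 where "x0 \<in> K" using per by blast
  then have K0: "0 \<in> K" using K_mult[of x0 0] by simp
  have C_trans: "C k x z" if C: "C k x y" "C k y z" for k x y z
  proof -
    obtain u v where "x - y - of_nat q ^ k * u \<in> K" "y - z - of_nat q ^ k * v \<in> K"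
      using C unfolding C_def by auto
    then have "(x - y - of_nat q ^ k * u) + (y - z - of_nat q ^ k * v) \<in> K" by (rule K_add)
    then have "x - z - of_nat q ^ k * (u + v) \<in> K" by (simp add: algebra_simps)
    then show ?thesis unfolding C_def by blast
  qed
  have C_mult: "C k (z * x) (z * y)" if C: "C k x y" for k x y z
  proof -
    obtain u where "x - y - of_nat q ^ k * u \<in> K" using C unfolding C_def by auto
    then have "z * (x - y - of_nat q ^ k * u) \<in> K" by (rule K_mult)
    then have "z * x - z * y - of_nat q ^ k * (z * u) \<in> K" by (simp add: algebra_simps)
    then show ?thesis unfolding C_def by blast
  qed
  \<comment> \<open>Taking q-th powers gains one factor \<open>q\<close>. After \<open>x\<close> is
    moved by an element of \<open>K\<close>, the cofactor of y' - y in y'^q - y^q is congruent to q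
    y^(q-1), hence to 0, modulo \<open>q\<close>.\<close>
  have C_raise: "C (Suc k) (x ^ q) (y ^ q)" if C: "C k x y" "k \<ge> 1" for k x y
  proof -
    obtain u where u: "x - y - of_nat q ^ k * u \<in> K" using C unfolding C_def by auto
    define y' where "y' = y + of_nat q ^ k * u"
    have "x - y' \<in> K" using u by (simp add: y'_def algebra_simps)
    moreover have "x - y' dvd x ^ q - y' ^ q" by (metis power_diff_sumr2 dvd_triv_left)
    ultimately have 1: "x ^ q - y' ^ q \<in> K" using K_mult by (metis dvdE mult.commute)
    have "of_nat q dvd y' - y" using \<open>k \<ge> 1\<close> by (simp add: y'_def dvd_power dvd_mult2)
    have "of_nat q dvd (\<Sum>i<q. y ^ (q - Suc i) * y' ^ i)"
    proof -
      have "(\<Sum>i<q. y ^ (q - Suc i) * y' ^ i) =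
          (\<Sum>i<q. y ^ (q - Suc i) * (y' ^ i - y ^ i)) + (\<Sum>i<q. y ^ (q - Suc i) * y ^ i)"
        by (simp add: sum.distrib[symmetric] algebra_simps)
      also have "(\<Sum>i<q. y ^ (q - Suc i) * y ^ i) = of_nat q * y ^ (q - 1)"
        by (simp add: power_add[symmetric])
      finally have "(\<Sum>i<q. y ^ (q - Suc i) * y' ^ i) =
          (\<Sum>i<q. y ^ (q - Suc i) * (y' ^ i - y ^ i)) + of_nat q * y ^ (q - 1)" .
      moreover have "of_nat q dvd y' ^ i - y ^ i" for i
        using \<open>of_nat q dvd y' - y\<close> dvd_trans by (metis power_diff_sumr2 dvd_triv_left)
      ultimately show ?thesis by (simp add: dvd_sum)
    qed
    then obtain t where "(\<Sum>i<q. y ^ (q - Suc i) * y' ^ i) = of_nat q * t" by (rule dvdE)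
    then have "y' ^ q - y ^ q = of_nat q ^ Suc k * (u * t)"
      using power_diff_sumr2[of y' q y] by (simp add: y'_def mult_ac)
    then have "x ^ q - y ^ q - of_nat q ^ Suc k * (u * t) = x ^ q - y' ^ q" by (simp add: algebra_simps)
    then show ?thesis unfolding C_def using 1 by metis
  qed
  define e where "e = w ^ (Q - 1)"
  define E where "E = e ^ (q ^ b)"
  have ew: "e * w = w ^ Q" using Q by (simp add: e_def power_Suc2[symmetric] del: power_Suc)
  have Cew: "C 1 (e * w) w" unfolding C_def ew using per[of w] by simp
  have Cee: "C 1 (e * e) e"
  proof -
    have "Q - 1 = Suc (Q - 2)" using Q by simp
    then have "e = w ^ (Q - 2) * w" unfolding e_def by (simp only: power_Suc2)
    then show ?thesis using C_mult[OF Cew, of "w ^ (Q - 2)"] by (simp add: mult_ac)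
  qed
  have C_refl: "C k x x" for k x unfolding C_def using K0 by (intro exI[of _ 0]) simp
  have Cej: "C 1 (e ^ Suc j) e" for j
  proof (induction j)
    case 0 then show ?case using C_refl by simp
  next
    case (Suc j)
    have "C 1 (e * e ^ Suc j) (e * e)" using Suc by (rule C_mult)
    then have "C 1 (e * e ^ Suc j) e" using Cee C_trans by blast
    then show ?case by simp
  qed
  obtain t where "s e - e ^ q = of_nat q * t" using frob[of e] by (rule dvdE)
  then have "C 1 (s e) (e ^ q)" unfolding C_def using K0 by (intro exI[of _ t]) simp
  then have "C 1 (s e) e" using Cej[of "q - 1"] q C_trans by (metis Suc_diff_1)
  \<comment> \<open>The start is s e = e^q = e modulo \<open>q\<close>, by idempotence of
    \<open>e\<close>. After b further q-th powers the congruence holds modulo q^(b+1), which lies in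
    \<open>I\<close>.\<close>
  then have "C (Suc j) (s e ^ (q ^ j)) (e ^ (q ^ j))" for j
  proof (induction j)
    case (Suc j)
    then have "C (Suc (Suc j)) ((s e ^ (q ^ j)) ^ q) ((e ^ (q ^ j)) ^ q)" by (intro C_raise) auto
    then show ?case by (simp add: power_mult[symmetric] mult.commute)
  qed simp
  then have "C (Suc b) (s E) E" by (simp add: E_def s_power)
  then obtain u where u: "s E - E - of_nat q ^ Suc b * u \<in> K" using C_def by auto
  have "E \<in> I"
  proof -
    have "w dvd E" using q Q unfolding E_def e_def by (simp add: power_mult[symmetric] dvd_power)
    then show ?thesis using I_mult Suc.prems(5) by (metis dvdE mult.commute)
  qed
  have "s E \<in> I"
  proof -
    have "(s E - E - of_nat q ^ Suc b * u) + (E + u * of_nat q ^ Suc b) \<in> I"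
      using u KI \<open>E \<in> I\<close> I_mult[OF Suc.prems(4)] by (intro I_add) auto
    then show ?thesis by (simp add: algebra_simps)
  qed
  have "C 1 (w * E) (w * e)"
    unfolding E_def using Cej[of "q ^ b - 1"] q by (intro C_mult) simp
  then have "C 1 (w * E) w" using Cew C_trans by (metis mult.commute)
  then obtain w1' where w1': "w * E - w - of_nat q * w1' \<in> K" unfolding C_def by auto
  define w1 where "w1 = - w1'"
  define \<kappa> where "\<kappa> = (- 1) * (w * E - w - of_nat q * w1')"
  have \<kappa>: "\<kappa> \<in> K" unfolding \<kappa>_def using w1' by (rule K_mult)
  have weq: "w = E * w + (of_nat q * w1 + \<kappa>)" by (simp add: \<kappa>_def w1_def algebra_simps)
  define I' where "I' = {x. of_nat q * x \<in> I}"
  have "s w1 \<in> I'"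
  proof (rule Suc.IH)
    show "x + y \<in> I'" if "x \<in> I'" "y \<in> I'" for x y
      using that I_add by (simp add: I'_def distrib_left)
    show "y * x \<in> I'" if "x \<in> I'" for x y
      using that I_mult by (simp add: I'_def mult.left_commute)
    show "K \<subseteq> I'" using KI K_mult by (auto simp: I'_def)
    show "of_nat q ^ b \<in> I'" using Suc.prems(4) by (simp add: I'_def)
    have "w + ((- E) * w + (- 1) * \<kappa>) \<in> I"
      using Suc.prems(5) \<kappa> KI by (intro I_add I_mult) auto
    moreover have "w + ((- E) * w + (- 1) * \<kappa>) = of_nat q * w1"
      using weq by (simp add: algebra_simps)
    ultimately show "w1 \<in> I'" by (simp add: I'_def)
  qed
  then have "of_nat q * s w1 \<in> I" by (simp add: I'_def)
  moreover have "s w = s w * s E + (of_nat q * s w1 + s \<kappa>)"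
    using arg_cong[OF weq, of s] by (simp add: s_add s_mult s_q mult.commute)
  moreover have "s w * s E \<in> I" using \<open>s E \<in> I\<close> by (rule I_mult)
  moreover have "s \<kappa> \<in> I" using \<kappa> s_K KI by blast
  ultimately show ?case using I_add by metis
qed

text \<open>Since Y * cnj Y = q^b, the condition defining \<open>I\<close> says that
  \<open>Y\<close> divides the value of \<open>w\<close>, without mentioning a quotient. This ideal
  contains q^b, so it is stable under Frobenius, and the conjugate of \<open>Y\<close> is a multiple
  of \<open>Y\<close>. Conjugating Y * cnj Y = q^b then gives the factor absolute value 1. The
  ideals are taken in the polynomial ring, where substituting x^q is an endomorphism.\<close>

lemma frobenius_conjugate_multiple:
  assumes N: "N > 0" and q: "prime q" "coprime q N"
    and Y: "Y \<in> int_adjoin (zeta N)" "Y * cnj Y = of_nat (q ^ b)"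
  obtains \<epsilon> where "\<epsilon> \<in> int_adjoin (zeta N)" "\<epsilon> * cnj \<epsilon> = 1" "gal N (q ^ j) Y = \<epsilon> * Y"
proof -
  have q1: "q > 1" using q(1) prime_gt_1_nat by blast
  have qj: "coprime (q ^ j) N" using q(2) by simp
  obtain f where f: "Y = ev f (zeta N)" using Y(1) by (rule int_adjoinE)
  define I where "I = {w. \<exists>g. cnj Y * ev w (zeta N) = of_nat (q ^ b) * ev g (zeta N)}"
  define K where "K = {w. ev w (zeta N) = 0}"
  define s where "s = (\<lambda>w::int poly. pcompose w (monom 1 q))"
  \<comment> \<open>By Euler's theorem this exponent is 1 modulo \<open>N\<close>, so the
    corresponding power of Frobenius fixes \<open>zeta N\<close> and x^Q = x holds modulo
    \<open>q\<close> and \<open>K\<close>.\<close>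
  define Q where "Q = q ^ totient N"
  have ev_s: "ev (s w) (zeta N) = ev w (zeta N ^ q)" for w
    unfolding s_def ev_pcompose ev_monom by simp
  have step: "s w \<in> I" if "w \<in> I" for w
  proof (rule frobenius_stable_ideal[where s = s and w = w and I = I and q = q and Q = Q and K = K and b = b])
    show "q > 0" using q1 by simp
    have "totient N > 0" using N by simp
    from one_less_power[OF q1 this] show "Q \<ge> 2" by (simp add: Q_def)
    show "s (x + y) = s x + s y" "s (x * y) = s x * s y" "s (x ^ k) = s x ^ k" for x y k
      by (simp_all add: s_def pcompose_add pcompose_mult pcompose_hom.hom_power)
    show "s (of_nat q) = of_nat q" by (simp add: s_def of_nat_poly)
    show "of_nat q dvd s x - x ^ q" for x
      using frobenius_poly[OF q(1), of x] unfolding s_def by (metis dvd_minus_iff minus_diff_eq)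
    show "x + y \<in> K" if "x \<in> K" "y \<in> K" for x y using that by (simp add: K_def ev_add)
    show "y * x \<in> K" if "x \<in> K" for x y using that by (simp add: K_def ev_mult)
    show "s x \<in> K" if "x \<in> K" for x
      using that root_transfer[of N "zeta N" q x] N q(2) by (simp add: K_def ev_s zeta_power_self)
    show "\<exists>u. x ^ Q - x - of_nat q * u \<in> K" for x
    proof -
      obtain u where u: "x ^ Q - pcompose x (monom 1 Q) = of_nat q * u"
        using frobenius_poly_power[OF q(1), of x "totient N"] by (auto simp: Q_def elim: dvdE)
      have "zeta N ^ Q = zeta N ^ 1"
        unfolding Q_def using euler_theorem[OF q(2)] N by (intro zeta_power_cong)
      then have "ev (pcompose x (monom 1 Q)) (zeta N) = ev x (zeta N)"
        unfolding ev_pcompose ev_monom by simp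
      moreover have "x ^ Q - x - of_nat q * u = pcompose x (monom 1 Q) - x" using u by (simp add: algebra_simps)
      ultimately have "ev (x ^ Q - x - of_nat q * u) (zeta N) = 0" by (simp only: ev_diff) simp
      then show ?thesis unfolding K_def by blast
    qed
    show "x + y \<in> I" if "x \<in> I" "y \<in> I" for x y
    proof -
      obtain g h where "cnj Y * ev x (zeta N) = of_nat (q ^ b) * ev g (zeta N)"
        "cnj Y * ev y (zeta N) = of_nat (q ^ b) * ev h (zeta N)" using \<open>x \<in> I\<close> \<open>y \<in> I\<close> by (auto simp: I_def)
      then have "cnj Y * ev (x + y) (zeta N) = of_nat (q ^ b) * ev (g + h) (zeta N)"
        unfolding ev_add by (simp add: distrib_left)
      then show ?thesis unfolding I_def by blast
    qed
    show "y * x \<in> I" if xI: "x \<in> I" for x y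
    proof -
      obtain g where "cnj Y * ev x (zeta N) = of_nat (q ^ b) * ev g (zeta N)" using xI by (auto simp: I_def)
      then have "cnj Y * ev (y * x) (zeta N) = of_nat (q ^ b) * ev (y * g) (zeta N)"
        unfolding ev_mult by (simp add: mult_ac)
      then show ?thesis unfolding I_def by blast
    qed
    show "K \<subseteq> I" unfolding I_def K_def using ev_0 by (metis (mono_tags) mem_Collect_eq mult_zero_right subsetI)
    obtain c where "cnj Y = ev c (zeta N)" using int_adjoin_cnj[OF N Y(1)] by (rule int_adjoinE)
    then have "cnj Y * ev (of_nat q ^ b) (zeta N) = of_nat (q ^ b) * ev c (zeta N)"
      by (simp add: ev_power ev_of_nat)
    then show "of_nat q ^ b \<in> I" unfolding I_def by blast
    show "w \<in> I" by (rule that)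
  qed
  have "cnj Y * ev f (zeta N) = of_nat (q ^ b) * ev 1 (zeta N)" using Y(2) by (simp add: f mult.commute)
  then have "f \<in> I" unfolding I_def by blast
  then have "(s ^^ j) f \<in> I" using step by (induction j) auto
  moreover have "ev ((s ^^ j) w) (zeta N) = ev w (zeta N ^ (q ^ j))" for w
  proof (induction j arbitrary: w)
    case (Suc j)
    have "ev ((s ^^ Suc j) w) (zeta N) = ev (s w) (zeta N ^ (q ^ j))"
      using Suc[of "s w"] by (simp add: funpow_swap1)
    also have "\<dots> = ev w ((zeta N ^ (q ^ j)) ^ q)" unfolding s_def ev_pcompose ev_monom by simp
    finally show ?case by (simp add: power_mult[symmetric] mult.commute)
  qed simp
  ultimately obtain g where g: "cnj Y * gal N (q ^ j) Y = of_nat (q ^ b) * ev g (zeta N)"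
    by (auto simp: I_def f gal_ev[OF N qj])
  define \<epsilon> where "\<epsilon> = ev g (zeta N)"
  have n0: "of_nat (q ^ b) \<noteq> (0::complex)" using q1 by simp
  have "of_nat (q ^ b) * gal N (q ^ j) Y = of_nat (q ^ b) * (\<epsilon> * Y)"
    using g by (simp only: Y(2)[symmetric] \<epsilon>_def) (metis mult.assoc mult.commute)
  then have eq: "gal N (q ^ j) Y = \<epsilon> * Y" using n0 mult_left_cancel by blast
  have "gal N (q ^ j) Y * cnj (gal N (q ^ j) Y) = gal N (q ^ j) (Y * cnj Y)"
    using Y(1) N by (simp add: gal_mult[OF N qj] gal_cnj[OF N qj] int_adjoin_cnj)
  also have "\<dots> = of_nat (q ^ b)" unfolding Y(2) by (rule gal_of_nat[OF N qj])
  finally have "(Y * cnj Y) * (\<epsilon> * cnj \<epsilon>) = of_nat (q ^ b) * 1"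
    unfolding eq by (simp add: mult_ac)
  then have "of_nat (q ^ b) * (\<epsilon> * cnj \<epsilon>) = of_nat (q ^ b) * 1" by (simp only: Y(2))
  then have "\<epsilon> * cnj \<epsilon> = 1" using n0 mult_left_cancel by blast
  then show ?thesis using that[of \<epsilon>] eq \<epsilon>_def by simp
qed

section \<open>Sparse expansions\<close>

lemma zeta_conj_product:
  assumes "N > 0" "j \<le> N"
  shows "zeta N ^ (i * l) * cnj (zeta N ^ (j * l)) = zeta N ^ (l * (i + (N - j)))"
proof -
  have "j * l + l * (N - j) = N * l" using assms(2) by (simp add: algebra_simps flip: distrib_left)
  then have "cnj (zeta N ^ (j * l)) = zeta N ^ (l * (N - j))"
    by (intro cnj_zeta_power assms(1)) (simp add: cong_def)
  then show ?thesis by (simp add: power_add[symmetric] algebra_simps)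
qed

lemma sum_pair_differences:
  fixes a :: "nat \<Rightarrow> complex"
  shows "(\<Sum>i<p. \<Sum>j<p. (a i - a j) * cnj (a i - a j)) =
    2 * (of_nat p * (\<Sum>i<p. a i * cnj (a i)) - (\<Sum>i<p. a i) * cnj (\<Sum>i<p. a i))"
proof -
  have "(\<Sum>i<p. \<Sum>j<p. (a i - a j) * cnj (a i - a j)) =
    (\<Sum>i<p. \<Sum>j<p. a i * cnj (a i)) + (\<Sum>i<p. \<Sum>j<p. a j * cnj (a j))
    - (\<Sum>i<p. \<Sum>j<p. a i * cnj (a j)) - (\<Sum>i<p. \<Sum>j<p. a j * cnj (a i))"
    by (simp only: sum.distrib[symmetric] sum_subtractf[symmetric]) (simp add: algebra_simps)
  also have "(\<Sum>i<p. \<Sum>j<p. a j * cnj (a i)) = (\<Sum>i<p. \<Sum>j<p. a i * cnj (a j))"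
    by (rule sum.swap)
  also have "(\<Sum>i<p. \<Sum>j<p. a i * cnj (a j)) = (\<Sum>i<p. a i) * cnj (\<Sum>i<p. a i)"
    by (simp add: sum_product)
  finally show ?thesis by (simp add: sum_distrib_left algebra_simps)
qed

context
  fixes p r :: nat
  assumes p: "prime p" and r: "r > 0" and pr: "coprime p r"
begin

lemma p_pos: "p > 0" and N_pos: "p * r > 0"
  using prime_gt_0_nat[OF p] r by auto

lemma zeta_r_subset: "x \<in> int_adjoin (zeta r) \<Longrightarrow> x \<in> int_adjoin (zeta (p * r))"
  by (metis int_adjoin_power_subset p_pos zeta_mult_power)

lemma zeta_p_power: "zeta p ^ i = zeta (p * r) ^ (r * i)"
  by (metis power_mult zeta_mult_power r mult.commute)

lemma zeta_p_in: "zeta p ^ i \<in> int_adjoin (zeta (p * r))"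
  unfolding zeta_p_power by (rule int_adjoin_power_gen)

text \<open>With u inverse to r modulo p and v inverse to p modulo r,
  \<open>zeta (p * r) = zeta p ^ u * zeta r ^ v\<close>. The terms are then grouped by the resulting
  exponent of \<open>zeta p\<close>.\<close>

lemma expand_over_zeta_r:
  assumes "X \<in> int_adjoin (zeta (p * r))"
  obtains a where "\<And>i. a i \<in> int_adjoin (zeta r)" "X = (\<Sum>i<p. a i * zeta p ^ i)"
proof -
  obtain f where f: "X = ev f (zeta (p * r))" using assms by (rule int_adjoinE)
  obtain u where u: "[r * u = 1] (mod p)" using cong_solve_coprime_nat[of r p] pr
    by (auto simp: coprime_commute)
  obtain v where v: "[p * v = 1] (mod r)" using cong_solve_coprime_nat[OF pr] by auto
  have "[r * u + p * v = 1 + 0] (mod p)" by (intro cong_add u) (simp add: cong_def)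
  moreover have "[r * u + p * v = 0 + 1] (mod r)" by (intro cong_add v) (simp add: cong_def)
  ultimately have "[r * u + p * v = 1] (mod (p * r))"
    using pr by (intro coprime_cong_mult_nat) simp_all
  then have "zeta (p * r) ^ (r * u + p * v) = zeta (p * r) ^ 1"
    by (rule zeta_power_cong[OF N_pos])
  moreover have "zeta (p * r) ^ r = zeta p" using zeta_p_power[of 1] by simp
  moreover have "zeta (p * r) ^ p = zeta r" by (rule zeta_mult_power[OF p_pos])
  ultimately have z: "zeta (p * r) = zeta p ^ u * zeta r ^ v"
    by (simp add: power_add power_mult)
  have zj: "zeta (p * r) ^ j = zeta r ^ (v * j) * zeta p ^ (u * j mod p)" for j
    unfolding z by (simp add: power_mult_distrib power_mult[symmetric] zeta_power_mod p_pos)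
  define a where "a i = (\<Sum>j\<in>{j\<in>{..degree f}. u * j mod p = i}. of_int (coeff f j) * zeta r ^ (v * j))" for i
  have "X = (\<Sum>j\<le>degree f. of_int (coeff f j) * zeta r ^ (v * j) * zeta p ^ (u * j mod p))"
    unfolding f ev_coeffs zj by (simp add: mult_ac)
  also have "\<dots> = (\<Sum>i<p. \<Sum>j\<in>{j\<in>{..degree f}. u * j mod p = i}.
      of_int (coeff f j) * zeta r ^ (v * j) * zeta p ^ (u * j mod p))"
    by (rule sum.group[symmetric]) (auto simp: p_pos)
  also have "\<dots> = (\<Sum>i<p. a i * zeta p ^ i)"
    unfolding a_def by (intro sum.cong refl) (simp add: sum_distrib_right)
  finally have "X = (\<Sum>i<p. a i * zeta p ^ i)" .
  moreover have "a i \<in> int_adjoin (zeta r)" for i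
    unfolding a_def by (intro int_adjoin_sum int_adjoin_mult int_adjoin_of_int int_adjoin_power_gen)
  ultimately show ?thesis using that by blast
qed

lemma gal_expansion:
  assumes k: "coprime k (p * r)" and a: "\<And>i. a i \<in> int_adjoin (zeta r)"
  shows "gal (p * r) k (\<Sum>i<p. a i * zeta p ^ i) = (\<Sum>i<p. gal r k (a i) * zeta p ^ (k * i))"
proof -
  have "gal (p * r) k (\<Sum>i<p. a i * zeta p ^ i) = (\<Sum>i<p. gal (p * r) k (a i * zeta p ^ i))"
    by (intro gal_sum[OF N_pos k] int_adjoin_mult zeta_r_subset a zeta_p_in)
  also have "\<dots> = (\<Sum>i<p. gal (p * r) k (a i) * gal (p * r) k (zeta p ^ i))"
    by (intro sum.cong refl gal_mult[OF N_pos k] zeta_r_subset a zeta_p_in)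
  also have "\<dots> = (\<Sum>i<p. gal r k (a i) * zeta p ^ (k * i))"
  proof (intro sum.cong refl arg_cong2[where f = "(*)"])
    fix i
    show "gal (p * r) k (a i) = gal r k (a i)" using a by (intro gal_tower[OF N_pos k refl])
    show "gal (p * r) k (zeta p ^ i) = zeta p ^ (k * i)"
      unfolding zeta_p_power gal_zeta_power[OF N_pos k] by (simp add: mult_ac)
  qed
  finally show ?thesis .
qed

text \<open>Parseval for the transform \<open>S\<close>. For 0 < l < p, \<open>S l\<close> is a
  conjugate of \<open>X\<close> over \<open>zeta r\<close> and contributes n; the remaining value
  \<open>S 0\<close> is the sum of the coefficients and is absorbed by passing to pair differences.
  These are unaffected by a common shift of all coefficients.\<close>

lemma energy:
  assumes a: "\<And>i. a i \<in> int_adjoin (zeta r)"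
    and X: "X = (\<Sum>i<p. a i * zeta p ^ i)" and n: "X * cnj X = of_nat n"
  shows "(\<Sum>i<p. \<Sum>j<p. (a i - a j) * cnj (a i - a j)) = of_nat (2 * (p - 1) * n)"
proof -
  define S where "S l = (\<Sum>i<p. a i * zeta p ^ (i * l))" for l
  have XN: "X \<in> int_adjoin (zeta (p * r))"
    unfolding X by (intro int_adjoin_sum int_adjoin_mult zeta_r_subset a zeta_p_in)
  have S: "S l * cnj (S l) = of_nat n" if l: "l \<in> {1..<p}" for l
  proof -
    \<comment> \<open>This exponent gives the conjugation that fixes \<open>zeta r\<close> and maps
      \<open>zeta p\<close> to its l-th power.\<close>
    obtain k where k: "[k = l] (mod p)" "[k = 1] (mod r)"
      using binary_chinese_remainder_nat[OF pr] by blast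
    have "\<not> p dvd l" using l nat_dvd_not_less[of l p] by auto
    then have "coprime l p" using prime_imp_coprime[OF p, of l] by (simp add: coprime_commute)
    then have "coprime k p" using k(1) by (metis cong_imp_coprime cong_sym)
    moreover have kr: "coprime k r" using k(2) by (metis cong_imp_coprime cong_sym coprime_1_left)
    ultimately have kN: "coprime k (p * r)" by simp
    have "zeta p ^ (k * i) = zeta p ^ (i * l)" for i
      using k(1) by (intro zeta_power_cong p_pos) (metis cong_scalar_right mult.commute)
    then have "gal (p * r) k X = S l"
      unfolding X gal_expansion[OF kN a] S_def using gal_cong_1[OF r kr k(2)] a by simp
    moreover have "gal (p * r) k X * cnj (gal (p * r) k X) = gal (p * r) k (X * cnj X)"
      using XN N_pos by (simp add: gal_mult[OF N_pos kN] gal_cnj[OF N_pos kN] int_adjoin_cnj)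
    ultimately show ?thesis unfolding n gal_of_nat[OF N_pos kN] by simp
  qed
  have orth: "(\<Sum>l<p. zeta p ^ (i * l) * cnj (zeta p ^ (j * l))) = (if i = j then of_nat p else 0)"
    if "i < p" "j < p" for i j
  proof -
    have "(\<Sum>l<p. zeta p ^ (i * l) * cnj (zeta p ^ (j * l))) = (\<Sum>l<p. zeta p ^ (l * (i + (p - j))))"
      using that by (intro sum.cong refl zeta_conj_product) auto
    also have "\<dots> = (if p dvd i + (p - j) then of_nat p else 0)"
      by (rule sum_zeta_powers[OF p_pos])
    also have "p dvd i + (p - j) \<longleftrightarrow> i = j"
    proof
      assume "p dvd i + (p - j)"
      then obtain c where c: "i + (p - j) = p * c" by (rule dvdE)
      then have "p * c < p * 2" "p * c > 0" using that by linarith+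
      then have "c = 1" by (simp add: less_2_cases_iff)
      then show "i = j" using c that by simp
    qed (use that in simp)
    finally show ?thesis .
  qed
  have "(\<Sum>l<p. S l * cnj (S l)) =
      (\<Sum>l<p. \<Sum>i<p. \<Sum>j<p. a i * cnj (a j) * (zeta p ^ (i * l) * cnj (zeta p ^ (j * l))))"
    by (simp add: S_def sum_product mult_ac)
  also have "\<dots> = (\<Sum>i<p. \<Sum>j<p. \<Sum>l<p. a i * cnj (a j) * (zeta p ^ (i * l) * cnj (zeta p ^ (j * l))))"
    by (subst sum.swap) (intro sum.cong refl sum.swap)
  also have "\<dots> = (\<Sum>i<p. \<Sum>j<p. a i * cnj (a j) * (if i = j then of_nat p else 0))"
    by (intro sum.cong refl) (simp only: sum_distrib_left[symmetric] orth lessThan_iff)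
  also have "\<dots> = of_nat p * (\<Sum>i<p. a i * cnj (a i))"
    by (simp add: if_distrib[of "\<lambda>x. _ * x"] sum.delta' sum_distrib_left mult_ac cong: if_cong)
  finally have e1: "(\<Sum>l<p. S l * cnj (S l)) = of_nat p * (\<Sum>i<p. a i * cnj (a i))" .
  have "{..<p} = insert 0 {1..<p}" using p_pos by auto
  then have "(\<Sum>l<p. S l * cnj (S l)) = S 0 * cnj (S 0) + (\<Sum>l=1..<p. S l * cnj (S l))" by simp
  also have "(\<Sum>l=1..<p. S l * cnj (S l)) = of_nat ((p - 1) * n)" by (simp add: S)
  also have "S 0 = (\<Sum>i<p. a i)" by (simp add: S_def)
  finally show ?thesis using e1 unfolding sum_pair_differences mult.assoc[of 2] of_nat_mult[of 2] by (simp add: algebra_simps)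
qed

text \<open>The case n = 0 of \<open>energy\<close>: a sum of squared absolute values vanishes, so
  the only relations among the powers of \<open>zeta p\<close> have all coefficients equal.\<close>

lemma expansion_unique:
  assumes a: "\<And>i. a i \<in> int_adjoin (zeta r)"
    and X: "(\<Sum>i<p. a i * zeta p ^ i) = 0" and ij: "i < p" "j < p"
  shows "a i = a j"
proof -
  have "(\<Sum>i<p. \<Sum>j<p. (a i - a j) * cnj (a i - a j)) = 0"
    using energy[OF a X[symmetric], of 0] by simp
  then have "complex_of_real (\<Sum>i<p. \<Sum>j<p. (norm (a i - a j))\<^sup>2) = 0"
    by (simp only: complex_norm_square of_real_sum)
  then have "(\<Sum>i<p. \<Sum>j<p. (norm (a i - a j))\<^sup>2) = 0" by (simp only: of_real_eq_0_iff)
  then have "(\<Sum>j<p. (norm (a i - a j))\<^sup>2) = 0"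
    by (rule sum_nonneg_0[rotated 2]) (use ij in \<open>auto intro: sum_nonneg\<close>)
  then have "(norm (a i - a j))\<^sup>2 = 0"
    by (rule sum_nonneg_0[rotated 2]) (use ij in auto)
  then show ?thesis by simp
qed

text \<open>The right-hand side of \<open>energy\<close> is a rational integer, so the identity
  persists under every conjugation of \<open>zeta r\<close>. In the average over these conjugations
  each nonzero difference contributes at least 1.\<close>

lemma count_distinct_pairs:
  assumes a: "\<And>i. a i \<in> int_adjoin (zeta r)"
    and X: "X = (\<Sum>i<p. a i * zeta p ^ i)" and n: "X * cnj X = of_nat n"
  shows "(\<Sum>i<p. card {j. j < p \<and> a j \<noteq> a i}) \<le> 2 * (p - 1) * n"
proof -
  have each: "(\<Sum>i<p. \<Sum>j<p. (norm (gal r s (a i - a j)))\<^sup>2) = real (2 * (p - 1) * n)"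
    if "s \<in> units_below r" for s
  proof -
    have s: "coprime s r" using that by (simp add: units_below_def)
    have in_r: "a i - a j \<in> int_adjoin (zeta r)" for i j by (intro int_adjoin_diff a)
    have "complex_of_real (\<Sum>i<p. \<Sum>j<p. (norm (gal r s (a i - a j)))\<^sup>2) =
       (\<Sum>i<p. \<Sum>j<p. gal r s (a i - a j) * cnj (gal r s (a i - a j)))"
      by (simp only: complex_norm_square of_real_sum)
    also have "\<dots> = (\<Sum>i<p. \<Sum>j<p. gal r s ((a i - a j) * cnj (a i - a j)))"
      by (intro sum.cong refl) (simp only: gal_mult[OF r s] gal_cnj[OF r s] in_r int_adjoin_cnj[OF r])
    also have "\<dots> = gal r s (\<Sum>i<p. \<Sum>j<p. (a i - a j) * cnj (a i - a j))"
      by (simp only: gal_sum[OF r s] in_r int_adjoin_cnj[OF r] int_adjoin_mult int_adjoin_sum)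
    also have "\<dots> = of_nat (2 * (p - 1) * n)"
      unfolding energy[OF a X n] by (rule gal_of_nat[OF r s])
    also have "\<dots> = complex_of_real (real (2 * (p - 1) * n))" by (simp only: of_real_of_nat_eq)
    finally show ?thesis by (simp only: of_real_eq_iff)
  qed
  define c where "c = card (units_below r)"
  have "c > 0" unfolding c_def using units_below_nonempty[OF r] .
  have pair: "(\<Sum>s\<in>units_below r. (norm (gal r s (a i - a j)))\<^sup>2) \<ge> (if a j \<noteq> a i then real c else 0)" for i j
    using sum_norm_gal_ge[OF r, of "a i - a j"] int_adjoin_diff[OF a a, of i j]
    by (auto simp: c_def intro: sum_nonneg)
  have "real c * (\<Sum>i<p. card {j. j < p \<and> a j \<noteq> a i}) = (\<Sum>i<p. \<Sum>j<p. if a j \<noteq> a i then real c else 0)"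
  proof -
    have "(\<Sum>j<p. if a j \<noteq> a i then real c else 0) = real c * card {j. j < p \<and> a j \<noteq> a i}" for i
    proof -
      have "(\<Sum>j<p. if a j \<noteq> a i then real c else 0) = (\<Sum>j\<in>{j\<in>{..<p}. a j \<noteq> a i}. real c)"
        by (rule sum.inter_filter[symmetric]) simp
      also have "{j\<in>{..<p}. a j \<noteq> a i} = {j. j < p \<and> a j \<noteq> a i}" by auto
      finally show ?thesis by simp
    qed
    then show ?thesis by (simp add: sum_distrib_left)
  qed
  also have "\<dots> \<le> (\<Sum>i<p. \<Sum>j<p. \<Sum>s\<in>units_below r. (norm (gal r s (a i - a j)))\<^sup>2)"
    by (intro sum_mono pair)
  also have "\<dots> = (\<Sum>i<p. \<Sum>s\<in>units_below r. \<Sum>j<p. (norm (gal r s (a i - a j)))\<^sup>2)"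
    by (intro sum.cong refl sum.swap)
  also have "\<dots> = (\<Sum>s\<in>units_below r. \<Sum>i<p. \<Sum>j<p. (norm (gal r s (a i - a j)))\<^sup>2)"
    by (rule sum.swap)
  also have "\<dots> = real c * real (2 * (p - 1) * n)" by (simp add: each c_def)
  finally have "real (\<Sum>i<p. card {j. j < p \<and> a j \<noteq> a i}) \<le> real (2 * (p - 1) * n)"
    using \<open>c > 0\<close> by (simp only: mult_le_cancel_left_pos of_nat_0_less_iff)
  then show ?thesis by (simp only: of_nat_le_iff)
qed

text \<open>Some value is attained by \<open>p - s\<close> coefficients with \<open>s < 2 n\<close>. Counting the pairs between
  this class and its complement gives \<open>(p - s) s \<le> (p - 1) n\<close>, which for
  \<open>p > n\<^sup>2 + n + 1\<close> fails at \<open>s = n + 1\<close> and hence for all \<open>s\<close> between \<open>n + 1\<close> and \<open>2 n\<close>.\<close>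
lemma sparse_expansion:
  assumes X: "X \<in> int_adjoin (zeta (p * r))" and n: "X * cnj X = of_nat n"
    and large: "p > n ^ 2 + n + 1"
  obtains b where "\<And>i. b i \<in> int_adjoin (zeta r)" "X = (\<Sum>i<p. b i * zeta p ^ i)"
    "card {i. i < p \<and> b i \<noteq> 0} \<le> n"
proof -
  obtain a where a: "\<And>i. a i \<in> int_adjoin (zeta r)" and Xa: "X = (\<Sum>i<p. a i * zeta p ^ i)"
    using expand_over_zeta_r[OF X] by blast
  define s where "s i = card {j. j < p \<and> a j \<noteq> a i}" for i
  have tot: "(\<Sum>i<p. s i) \<le> 2 * (p - 1) * n" unfolding s_def by (rule count_distinct_pairs[OF a Xa n])
  have "\<exists>i<p. s i \<le> 2 * n"
  proof (rule ccontr)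
    assume "\<not> (\<exists>i<p. s i \<le> 2 * n)"
    then have "s i > 2 * n" if "i < p" for i using that not_le by blast
    then have "(\<Sum>i<p. 2 * n) < (\<Sum>i<p. s i)" using p_pos by (intro sum_strict_mono) auto
    then have "p * (2 * n) < (\<Sum>i<p. s i)" by simp
    then have "p * (2 * n) < 2 * (p - 1) * n" using tot by linarith
    moreover have "2 * (p - 1) * n \<le> p * (2 * n)" by (simp add: algebra_simps)
    ultimately show False using leD by blast
  qed
  then obtain i0 where i0: "i0 < p" "s i0 \<le> 2 * n" by blast
  define A where "A = {j. j < p \<and> a j \<noteq> a i0}"
  define B where "B = {j. j < p \<and> a j = a i0}"
  have AB: "{..<p} = A \<union> B" "A \<inter> B = {}" "finite A" "finite B" by (auto simp: A_def B_def)
  have cAB: "card A + card B = p" using AB card_Un_disjoint[of A B] by (metis card_lessThan)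
  have cA: "card A = s i0" by (simp add: A_def s_def)
  have sA: "s i \<ge> card B" if "i \<in> A" for i
    unfolding s_def using that by (intro card_mono) (auto simp: A_def B_def)
  have sB: "s i = card A" if "i \<in> B" for i
    using that by (simp add: A_def B_def s_def)
  have "(\<Sum>i<p. s i) = (\<Sum>i\<in>A. s i) + (\<Sum>i\<in>B. s i)" using AB by (simp add: sum.union_disjoint)
  moreover have "(\<Sum>i\<in>A. s i) \<ge> card A * card B" using sum_bounded_below[of A "card B" s] sA by simp
  moreover have "(\<Sum>i\<in>B. s i) = card B * card A" using sB by simp
  ultimately have "2 * (card A * card B) \<le> 2 * ((p - 1) * n)" using tot by (simp add: mult_ac)
  then have key: "card A * card B \<le> (p - 1) * n" by simp
  have "card A \<le> n"
  proof (rule ccontr)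
    assume "\<not> card A \<le> n"
    then obtain t where t: "card A = n + 1 + t" using le_Suc_ex[of "n + 1" "card A"] by auto
    have t2: "t \<le> n - 1" "n > 0" using t cA i0 by auto
    define P where "P = int p"
    define m where "m = int n"
    define T where "T = int t"
    have iA: "int (card A) = m + 1 + T" using t by (simp add: m_def T_def)
    have iB: "int (card B) = P - m - 1 - T" using cAB t by (simp add: P_def m_def T_def)
    have iP: "int (p - 1) = P - 1" using p_pos by (simp add: P_def)
    have "int (card A * card B) \<le> int ((p - 1) * n)" using key by (simp only: of_nat_le_iff)
    then have k1: "(m + 1 + T) * (P - m - 1 - T) \<le> (P - 1) * m"
      by (simp only: of_nat_mult iA iB iP m_def)
    have "int (n ^ 2 + n + 1) < int p" using large by (simp only: of_nat_less_iff)
    then have L: "P \<ge> m * m + m + 2" by (simp add: P_def m_def power2_eq_square)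
    have T: "0 \<le> T" "T \<le> m - 1" using t2 by (auto simp: T_def m_def)
    \<comment> \<open>\<open>D\<close> is the change of s (p - s) as s moves from n + 1 to n + 1 +
      t. At s = n + 1 the value exceeds (p - 1) n by p - (n^2 + n + 1).\<close>
    define D where "D = T * (P - 2 * m - 2 - T)"
    have "0 \<le> D" unfolding D_def
    proof (rule mult_nonneg_nonneg)
      have "0 \<le> (m - 1) * (m - 1)" by simp
      then show "0 \<le> P - 2 * m - 2 - T" using L T by (simp add: algebra_simps)
    qed (rule T)
    have "(m + 1 + T) * (P - m - 1 - T) = (P - 1) * m + (P - (m * m + m + 1)) + D"
      by (simp add: D_def algebra_simps)
    then have "P - (m * m + m + 1) + D \<le> 0" using k1 by simp
    then show False using L \<open>0 \<le> D\<close> by simp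
  qed
  \<comment> \<open>Subtracting \<open>a i0\<close> from every coefficient is harmless because the
    powers of \<open>zeta p\<close> sum to 0.\<close>
  moreover have "X = (\<Sum>i<p. (a i - a i0) * zeta p ^ i)"
  proof -
    have "(\<Sum>i<p. zeta p ^ (i * 1)) = 0"
      using sum_zeta_powers[OF p_pos, of 1] prime_gt_1_nat[OF p] by (simp add: nat_dvd_1_iff_1)
    then show ?thesis unfolding Xa by (simp add: left_diff_distrib sum_subtractf sum_distrib_left[symmetric])
  qed
  moreover have "A = {i. i < p \<and> a i - a i0 \<noteq> 0}" by (auto simp: A_def)
  ultimately show ?thesis by (intro that[of "\<lambda>i. a i - a i0"] int_adjoin_diff a) simp_all
qed

end

section \<open>Determinants of midpoint systems\<close>

text \<open>The weight of a cycle with s rows of diagonal 3 and t rows of diagonal 2, fixed or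
  moved. Both assumptions exclude failures: t = 0 gives 3^s + 1, and s = 0, t = 1 gives 4 against
  3.\<close>

lemma cycle_weight_bound:
  assumes "t \<ge> 1" "s + t \<ge> 2"
  shows "3 ^ s * 2 ^ t + 2 ^ t \<le> (3::nat) ^ (s + t)"
proof (cases s)
  case 0
  then obtain u where u: "t = Suc (Suc u)" using assms by (metis add_0 add_2_eq_Suc le_Suc_ex)
  have "(2::nat) ^ u \<le> 3 ^ u" by (intro power_mono) auto
  then show ?thesis by (simp add: 0 u)
next
  case (Suc s')
  obtain u where u: "t = Suc u" using assms by (cases t) auto
  have "(2::nat) ^ u \<le> 3 ^ u" by (intro power_mono) auto
  then have "2 ^ u * (2 * (3 ^ s + 1)) \<le> 3 ^ u * (2 * (3 ^ s + 1::nat))" by (rule mult_right_mono) simp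
  also have "\<dots> \<le> 3 ^ u * (3 * 3 ^ s)"
  proof (rule mult_left_mono)
    define x where "x = (3::nat) ^ s'"
    have "1 \<le> x" by (simp add: x_def)
    then have "2 * (3 * x + 1) \<le> 3 * (3 * x)" by simp
    then show "2 * (3 ^ s + 1) \<le> 3 * (3::nat) ^ s" by (simp only: Suc power_Suc x_def)
  qed simp
  finally show ?thesis by (simp add: u power_add algebra_simps)
qed

text \<open>On the values 2 and 3 this is 4 - a: a row has total absolute weight 4, and this is the
  part off the diagonal.\<close>

definition off_weight :: "nat \<Rightarrow> nat" where
  "off_weight a = (if a = 3 then 1 else 2)"

lemma invariant_set_weight_bound:
  fixes f :: "'a \<Rightarrow> 'a"
  assumes W: "finite W" "W \<noteq> {}" "f ` W = W" and f: "\<And>i. i \<in> W \<Longrightarrow> f i \<noteq> i"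
    and a: "\<And>i. i \<in> W \<Longrightarrow> a i = 2 \<or> a i = (3::nat)" and i0: "i0 \<in> W" "a i0 = 2"
  shows "(\<Prod>i\<in>W. a i) + (\<Prod>i\<in>W. off_weight (a i)) \<le> 3 ^ card W"
proof -
  define T where "T = {i\<in>W. a i = 2}"
  define S where "S = {i\<in>W. a i = 3}"
  have WST: "W = S \<union> T" "S \<inter> T = {}" "finite S" "finite T" using a W(1) by (auto simp: S_def T_def)
  have cW: "card W = card S + card T" using WST by (simp add: card_Un_disjoint)
  have "(\<Prod>i\<in>W. a i) = (\<Prod>i\<in>S. a i) * (\<Prod>i\<in>T. a i)"
    using WST by (simp add: prod.union_disjoint)
  also have "(\<Prod>i\<in>S. a i) = 3 ^ card S" by (simp add: S_def)
  also have "(\<Prod>i\<in>T. a i) = 2 ^ card T" by (simp add: T_def)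
  finally have pa: "(\<Prod>i\<in>W. a i) = 3 ^ card S * 2 ^ card T" .
  have "(\<Prod>i\<in>W. off_weight (a i)) = (\<Prod>i\<in>S. off_weight (a i)) * (\<Prod>i\<in>T. off_weight (a i))"
    using WST by (simp add: prod.union_disjoint)
  also have "(\<Prod>i\<in>S. off_weight (a i)) = 1" by (simp add: S_def off_weight_def)
  also have "(\<Prod>i\<in>T. off_weight (a i)) = 2 ^ card T" by (simp add: T_def off_weight_def)
  finally have pc: "(\<Prod>i\<in>W. off_weight (a i)) = 2 ^ card T" by simp
  have "i0 \<in> T" using i0 by (simp add: T_def)
  then have "card T \<ge> 1" using card_gt_0_iff[of T] WST(4) by (auto simp: Suc_le_eq)
  moreover have "card {i0, f i0} \<le> card W" using W i0 by (intro card_mono) auto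
  then have "card W \<ge> 2" using f[OF i0(1)] by simp
  ultimately show ?thesis unfolding pa pc cW by (intro cycle_weight_bound) auto
qed

text \<open>Sets with \<open>f ` W = W\<close> are unions of cycles of \<open>f\<close>. A minimal one, \<open>W0\<close>, is contained in or
  disjoint from any other, so the sum factors with the factor of \<open>W0\<close> being at most
  \<open>3 ^ card W0\<close>.\<close>
lemma invariant_sets_sum_bound:
  fixes f :: "'a \<Rightarrow> 'a"
  assumes "finite U" and "\<And>i. i \<in> U \<Longrightarrow> f i \<noteq> i"
    and "\<And>i. i \<in> U \<Longrightarrow> a i = 2 \<or> a i = (3::nat)"
    and "\<And>W. W \<subseteq> U \<Longrightarrow> W \<noteq> {} \<Longrightarrow> f ` W = W \<Longrightarrow> \<exists>i\<in>W. a i = 2"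
  shows "(\<Sum>W | W \<subseteq> U \<and> f ` W = W. (\<Prod>i\<in>W. off_weight (a i)) * (\<Prod>i\<in>U - W. a i)) \<le> 3 ^ card U"
  using assms
proof (induction U rule: finite_psubset_induct)
  case (psubset U)
  define F where "F = (\<lambda>U. {W. W \<subseteq> U \<and> f ` W = W})"
  define wt where "wt = (\<lambda>U W. (\<Prod>i\<in>W. off_weight (a i)) * (\<Prod>i\<in>U - W. a i))"
  have a3: "a i \<le> 3" if "i \<in> U" for i using psubset.prems(2)[OF that] by auto
  show ?case
  proof (cases "F U = {{}}")
    case True
    have "(\<Prod>i\<in>U. a i) \<le> (\<Prod>i\<in>U. 3)" by (intro prod_mono) (use a3 in auto)
    then show ?thesis using True by (simp add: F_def)
  next
    case False
    have "{} \<in> F U" by (simp add: F_def)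
    with False have "\<exists>W. W \<in> F U \<and> W \<noteq> {}" by blast
    then obtain W0 where W0: "W0 \<in> F U" "W0 \<noteq> {}"
      and min: "\<And>W. W \<in> F U \<Longrightarrow> W \<noteq> {} \<Longrightarrow> card W0 \<le> card W"
      using ex_has_least_nat[of "\<lambda>W. W \<in> F U \<and> W \<noteq> {}" _ card] by blast
    have W0U: "W0 \<subseteq> U" "f ` W0 = W0" and finW0: "finite W0"
      using W0 psubset.hyps finite_subset by (auto simp: F_def)
    have dich: "W \<inter> W0 = {} \<or> W0 \<subseteq> W" if W: "W \<in> F U" for W
    proof -
      have WU: "W \<subseteq> U" "f ` W = W" "finite W" using W psubset.hyps finite_subset by (auto simp: F_def)
      have "f ` (W \<union> W0) = W \<union> W0" using WU W0U by (simp add: image_Un)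
      then have "inj_on f (W \<union> W0)" using WU finW0 by (intro eq_card_imp_inj_on) auto
      then have "f ` (W \<inter> W0) = f ` W \<inter> f ` W0" by (rule inj_on_image_Int) auto
      then have "W \<inter> W0 \<in> F U" using WU W0U by (auto simp: F_def)
      then have "W \<inter> W0 = {} \<or> card W0 \<le> card (W \<inter> W0)" using min by blast
      then show ?thesis using finW0 card_seteq[of W0 "W \<inter> W0"] by auto
    qed
    have FU: "F U = F (U - W0) \<union> (\<lambda>W. W \<union> W0) ` F (U - W0)"
    proof (intro equalityI subsetI)
      fix W assume W: "W \<in> F U"
      show "W \<in> F (U - W0) \<union> (\<lambda>W. W \<union> W0) ` F (U - W0)"
      proof (cases "W \<inter> W0 = {}")
        case True
        then show ?thesis using W by (auto simp: F_def)
      next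
        case ne: False
        have WU: "W \<subseteq> U" "f ` W = W" "finite W" using W psubset.hyps finite_subset by (auto simp: F_def)
        have sub: "W0 \<subseteq> W" using dich[OF W] ne by blast
        have "inj_on f W" using WU by (intro eq_card_imp_inj_on) auto
        then have "f ` (W - W0) = W - W0"
          using inj_on_image_set_diff[of f W W W0] WU W0U sub by auto
        then have "W - W0 \<in> F (U - W0)" using WU by (auto simp: F_def)
        moreover have "W = (W - W0) \<union> W0" using sub by blast
        ultimately show ?thesis by blast
      qed
    next
      fix W assume "W \<in> F (U - W0) \<union> (\<lambda>W. W \<union> W0) ` F (U - W0)"
      then show "W \<in> F U" using W0U by (auto simp: F_def image_Un)
    qed
    have fin: "finite (F (U - W0))"
      using psubset.hyps by (auto simp: F_def intro!: finite_subset[of _ "Pow U"])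
    have disj: "F (U - W0) \<inter> (\<lambda>W. W \<union> W0) ` F (U - W0) = {}"
      using W0(2) by (auto simp: F_def)
    have inj: "inj_on (\<lambda>W. W \<union> W0) (F (U - W0))"
      by (rule inj_onI) (auto simp: F_def)
    have w1: "wt U W = (\<Prod>i\<in>W0. a i) * wt (U - W0) W"
      and w2: "wt U (W \<union> W0) = (\<Prod>i\<in>W0. off_weight (a i)) * wt (U - W0) W"
      if W: "W \<in> F (U - W0)" for W
    proof -
      have WU: "W \<subseteq> U - W0" "finite W" using W psubset.hyps by (auto simp: F_def intro: finite_subset)
      have "U - W = W0 \<union> (U - W0 - W)" using WU W0U by blast
      then have "(\<Prod>i\<in>U - W. a i) = (\<Prod>i\<in>W0. a i) * (\<Prod>i\<in>U - W0 - W. a i)"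
        using finW0 psubset.hyps by (simp add: prod.union_disjoint Diff_eq Int_assoc)
      then show "wt U W = (\<Prod>i\<in>W0. a i) * wt (U - W0) W" by (simp add: wt_def mult_ac)
      have "U - (W \<union> W0) = U - W0 - W" by blast
      moreover have "(\<Prod>i\<in>W \<union> W0. off_weight (a i)) = (\<Prod>i\<in>W. off_weight (a i)) * (\<Prod>i\<in>W0. off_weight (a i))"
        using WU finW0 by (intro prod.union_disjoint) auto
      ultimately show "wt U (W \<union> W0) = (\<Prod>i\<in>W0. off_weight (a i)) * wt (U - W0) W"
        by (simp add: wt_def mult_ac)
    qed
    have "(\<Sum>W\<in>F U. wt U W) = (\<Sum>W\<in>F (U - W0). wt U W) + (\<Sum>W\<in>(\<lambda>W. W \<union> W0) ` F (U - W0). wt U W)"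
      unfolding FU using fin disj by (intro sum.union_disjoint) auto
    also have "(\<Sum>W\<in>(\<lambda>W. W \<union> W0) ` F (U - W0). wt U W) = (\<Sum>W\<in>F (U - W0). wt U (W \<union> W0))"
      using inj by (simp add: sum.reindex)
    also have "(\<Sum>W\<in>F (U - W0). wt U W) + (\<Sum>W\<in>F (U - W0). wt U (W \<union> W0)) =
      ((\<Prod>i\<in>W0. a i) + (\<Prod>i\<in>W0. off_weight (a i))) * (\<Sum>W\<in>F (U - W0). wt (U - W0) W)"
      by (simp add: w1 w2 sum_distrib_left distrib_right sum.distrib)
    also have "\<dots> \<le> 3 ^ card W0 * 3 ^ card (U - W0)"
    proof (rule mult_mono)
      obtain i0 where "i0 \<in> W0" "a i0 = 2" using psubset.prems(3)[OF W0U(1) W0(2) W0U(2)] by blast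
      then show "(\<Prod>i\<in>W0. a i) + (\<Prod>i\<in>W0. off_weight (a i)) \<le> 3 ^ card W0"
        using psubset.prems W0U finW0 W0(2) by (intro invariant_set_weight_bound) auto
      show "(\<Sum>W\<in>F (U - W0). wt (U - W0) W) \<le> 3 ^ card (U - W0)"
        unfolding F_def wt_def
      proof (rule psubset.IH)
        show "U - W0 \<subset> U" using W0U W0(2) by blast
        show "\<exists>i\<in>W. a i = 2" if "W \<subseteq> U - W0" "W \<noteq> {}" "f ` W = W" for W
          using psubset.prems(3)[of W] that by blast
      qed (use psubset.prems in auto)
    qed auto
    also have "\<dots> = 3 ^ card U"
      using W0U psubset.hyps finW0 by (simp add: power_add[symmetric] card_Diff_subset card_mono)
    finally show ?thesis by (simp add: F_def wt_def)
  qed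
qed

text \<open>A permutation contributes only if it fixes each point or moves it along
  \<open>f\<close>. It is then determined by the set of moved points, which \<open>f\<close> maps
  onto itself, so the permanent is at most the sum over invariant sets.\<close>

lemma functional_permanent_bound:
  fixes f :: "'a \<Rightarrow> 'a"
  assumes U: "finite U" and f: "\<And>i. i \<in> U \<Longrightarrow> f i \<noteq> i"
    and a: "\<And>i. i \<in> U \<Longrightarrow> a i = 2 \<or> a i = (3::nat)"
    and W: "\<And>W. W \<subseteq> U \<Longrightarrow> W \<noteq> {} \<Longrightarrow> f ` W = W \<Longrightarrow> \<exists>i\<in>W. a i = 2"
  shows "(\<Sum>\<pi> | \<pi> permutes U. \<Prod>i\<in>U. if \<pi> i = i then a i else if \<pi> i = f i then off_weight (a i) else 0)
    \<le> 3 ^ card U"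
proof -
  define t where "t = (\<lambda>\<pi>. \<Prod>i\<in>U. if \<pi> i = i then a i else if \<pi> i = f i then off_weight (a i) else 0)"
  define G where "G = {\<pi>. \<pi> permutes U \<and> (\<forall>i\<in>U. \<pi> i = i \<or> \<pi> i = f i)}"
  define D where "D = (\<lambda>\<pi>::'a \<Rightarrow> 'a. {i\<in>U. \<pi> i \<noteq> i})"
  define wt where "wt = (\<lambda>W. (\<Prod>i\<in>W. off_weight (a i)) * (\<Prod>i\<in>U - W. a i))"
  have "(\<Sum>\<pi> | \<pi> permutes U. t \<pi>) = (\<Sum>\<pi>\<in>G. t \<pi>)"
  proof (rule sum.mono_neutral_right)
    show "finite {\<pi>. \<pi> permutes U}" using U by (rule finite_permutations)
    show "G \<subseteq> {\<pi>. \<pi> permutes U}" by (auto simp: G_def)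
    show "\<forall>\<pi>\<in>{\<pi>. \<pi> permutes U} - G. t \<pi> = 0"
      using U by (auto simp: G_def t_def intro!: prod_zero)
  qed
  also have "\<dots> = (\<Sum>\<pi>\<in>G. wt (D \<pi>))"
  proof (rule sum.cong[OF refl])
    fix \<pi> assume \<pi>: "\<pi> \<in> G"
    have "U = D \<pi> \<union> (U - D \<pi>)" by (auto simp: D_def)
    then have "t \<pi> = (\<Prod>i\<in>D \<pi> \<union> (U - D \<pi>). if \<pi> i = i then a i else if \<pi> i = f i then off_weight (a i) else 0)"
      by (simp add: t_def)
    also have "\<dots> = (\<Prod>i\<in>D \<pi>. if \<pi> i = i then a i else if \<pi> i = f i then off_weight (a i) else 0) *
        (\<Prod>i\<in>U - D \<pi>. if \<pi> i = i then a i else if \<pi> i = f i then off_weight (a i) else 0)"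
      using U by (intro prod.union_disjoint) (auto simp: D_def)
    also have "\<dots> = wt (D \<pi>)"
      unfolding wt_def using \<pi> by (intro arg_cong2[where f = "(*)"] prod.cong) (auto simp: D_def G_def)
    finally show "t \<pi> = wt (D \<pi>)" .
  qed
  also have "\<dots> = (\<Sum>W\<in>D ` G. wt W)"
  proof -
    have "inj_on D G"
    proof (rule inj_onI, rule ext)
      fix \<pi> \<rho> i assume \<pi>: "\<pi> \<in> G" "\<rho> \<in> G" "D \<pi> = D \<rho>"
      show "\<pi> i = \<rho> i"
      proof (cases "i \<in> U")
        case False
        then show ?thesis using \<pi> by (simp add: G_def permutes_def)
      next
        case True
        then have "\<pi> i = (if i \<in> D \<pi> then f i else i)" "\<rho> i = (if i \<in> D \<rho> then f i else i)"
          using \<pi> by (auto simp: G_def D_def)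
        then show ?thesis using \<pi>(3) by simp
      qed
    qed
    then show ?thesis by (simp add: sum.reindex)
  qed
  also have "\<dots> \<le> (\<Sum>W | W \<subseteq> U \<and> f ` W = W. wt W)"
  proof (rule sum_mono2)
    show "finite {W. W \<subseteq> U \<and> f ` W = W}" using U by simp
    show "D ` G \<subseteq> {W. W \<subseteq> U \<and> f ` W = W}"
    proof (intro image_subsetI CollectI conjI)
      fix \<pi> assume \<pi>: "\<pi> \<in> G"
      show DU: "D \<pi> \<subseteq> U" by (auto simp: D_def)
      have perm: "\<pi> permutes U" using \<pi> by (simp add: G_def)
      have "f ` D \<pi> = \<pi> ` D \<pi>" using \<pi> by (intro image_cong) (auto simp: G_def D_def)
      also have "\<dots> = D \<pi>"
      proof (rule endo_inj_surj)
        show "finite (D \<pi>)" using DU U finite_subset by blast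
        show "inj_on \<pi> (D \<pi>)" using perm by (metis permutes_inj_on)
        show "\<pi> ` D \<pi> \<subseteq> D \<pi>"
        proof (rule image_subsetI)
          fix i assume "i \<in> D \<pi>"
          then have "i \<in> U" "\<pi> i \<noteq> i" by (auto simp: D_def)
          then have "\<pi> i \<in> U" "\<pi> (\<pi> i) \<noteq> \<pi> i"
            using permutes_in_image[OF perm] injD[OF permutes_inj[OF perm]] by auto
          then show "\<pi> i \<in> D \<pi>" by (simp add: D_def)
        qed
      qed
      finally show "f ` D \<pi> = D \<pi>" .
    qed
  qed simp
  also have "\<dots> \<le> 3 ^ card U"
    unfolding wt_def using U f a W by (rule invariant_sets_sum_bound)
  finally show ?thesis by (simp add: t_def)
qed

text \<open>Twice a row is dominated by the sum of two rows with a single off-diagonal entry each,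
  in column j or in column k. Expanding over all choices \<open>g\<close> gives 2 ^ card U matrices,
  each governed by one function, and the factor 2 ^ card U cancels.\<close>

lemma permanent_bound:
  fixes A :: "'a \<Rightarrow> 'a \<Rightarrow> nat" and j k :: "'a \<Rightarrow> 'a"
  assumes U: "finite U"
    and a: "\<And>i. i \<in> U \<Longrightarrow> a i = 2 \<or> a i = 3"
    and jk: "\<And>i. i \<in> U \<Longrightarrow> j i \<noteq> i" "\<And>i. i \<in> U \<Longrightarrow> k i \<noteq> i"
      "\<And>i. i \<in> U \<Longrightarrow> a i = 3 \<Longrightarrow> j i = k i"
    and diag: "\<And>i. i \<in> U \<Longrightarrow> A i i \<le> a i"
    and off: "\<And>i i'. i \<in> U \<Longrightarrow> i' \<in> U \<Longrightarrow> i' \<noteq> i \<Longrightarrow>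
      2 * A i i' \<le> off_weight (a i) * (of_bool (i' = j i) + of_bool (i' = k i))"
    and W: "\<And>W. W \<subseteq> U \<Longrightarrow> W \<noteq> {} \<Longrightarrow> j ` W = W \<Longrightarrow> \<exists>i\<in>W. a i = 2"
  shows "(\<Sum>\<pi> | \<pi> permutes U. \<Prod>i\<in>U. A i (\<pi> i)) \<le> 3 ^ card U"
proof -
  define f where "f = (\<lambda>g i. if g i then j i else k i)"
  define B where "B = (\<lambda>h i i'. if i' = i then a i else if i' = (if h then j i else k i) then off_weight (a i) else 0)"
  have AB: "2 * A i i' \<le> (\<Sum>h\<in>UNIV. B h i i')" if "i \<in> U" "i' \<in> U" for i i'
    using diag[OF that(1)] off[OF that] by (cases "i' = i") (auto simp: B_def UNIV_bool split: if_splits)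
  have fin: "finite {\<pi>. \<pi> permutes U}" using U by (rule finite_permutations)
  have "2 ^ card U * (\<Sum>\<pi> | \<pi> permutes U. \<Prod>i\<in>U. A i (\<pi> i)) =
      (\<Sum>\<pi> | \<pi> permutes U. \<Prod>i\<in>U. 2 * A i (\<pi> i))"
    by (simp add: sum_distrib_left prod.distrib)
  also have "\<dots> \<le> (\<Sum>\<pi> | \<pi> permutes U. \<Prod>i\<in>U. \<Sum>h\<in>UNIV. B h i (\<pi> i))"
    by (intro sum_mono prod_mono conjI AB) (auto simp: permutes_in_image)
  also have "\<dots> = (\<Sum>\<pi> | \<pi> permutes U. \<Sum>g\<in>PiE U (\<lambda>_. UNIV). \<Prod>i\<in>U. B (g i) i (\<pi> i))"
    by (intro sum.cong refl prod_sum_PiE U) simp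
  also have "\<dots> = (\<Sum>g\<in>PiE U (\<lambda>_. UNIV). \<Sum>\<pi> | \<pi> permutes U. \<Prod>i\<in>U. B (g i) i (\<pi> i))"
    by (rule sum.swap)
  also have "\<dots> \<le> (\<Sum>g\<in>PiE U (\<lambda>_. UNIV::bool set). 3 ^ card U)"
  proof (rule sum_mono)
    fix g
    have "(\<Sum>\<pi> | \<pi> permutes U. \<Prod>i\<in>U. B (g i) i (\<pi> i)) = (\<Sum>\<pi> | \<pi> permutes U. \<Prod>i\<in>U.
        if \<pi> i = i then a i else if \<pi> i = f g i then off_weight (a i) else 0)"
      unfolding B_def f_def by (rule refl)
    also have "\<dots> \<le> 3 ^ card U"
    proof (rule functional_permanent_bound[OF U _ a])
      show "f g i \<noteq> i" if "i \<in> U" for i using jk that by (simp add: f_def)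
      show "\<exists>i\<in>W. a i = 2" if WU: "W \<subseteq> U" "W \<noteq> {}" "f g ` W = W" for W
      proof (rule ccontr)
        \<comment> \<open>Where all diagonal entries are 3 the columns j and k agree, so every
          choice acts as \<open>j\<close> on \<open>W\<close>.\<close>
        assume no2: "\<not> (\<exists>i\<in>W. a i = 2)"
        then have "f g i = j i" if "i \<in> W" for i
          using a[of i] jk(3)[of i] WU(1) that by (auto simp: f_def)
        then have "j ` W = W" using WU(3) by auto
        then show False using W WU no2 by blast
      qed
    qed
    finally show "(\<Sum>\<pi> | \<pi> permutes U. \<Prod>i\<in>U. B (g i) i (\<pi> i)) \<le> 3 ^ card U" .
  qed
  also have "\<dots> = 2 ^ card U * 3 ^ card U" using U by (simp add: card_PiE)
  finally show ?thesis by simp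
qed

text \<open>The determinant \<open>d\<close> of the system is nonzero, \<open>p\<close> divides \<open>d * x i\<close> by multiplying with
  the adjugate, and \<open>\<bar>d\<bar> < p\<close>.\<close>
lemma mod_system_trivial:
  fixes A :: "'a \<Rightarrow> 'a \<Rightarrow> int" and j k :: "'a \<Rightarrow> 'a" and x :: "'a \<Rightarrow> int" and p :: nat
  assumes p: "prime p" "3 ^ card U < p" and U: "finite U"
    and a: "\<And>i. i \<in> U \<Longrightarrow> a i = 2 \<or> a i = 3"
    and jk: "\<And>i. i \<in> U \<Longrightarrow> j i \<noteq> i" "\<And>i. i \<in> U \<Longrightarrow> k i \<noteq> i"
      "\<And>i. i \<in> U \<Longrightarrow> a i = 3 \<Longrightarrow> j i = k i"
    and diag: "\<And>i. i \<in> U \<Longrightarrow> nat \<bar>A i i\<bar> \<le> a i"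
    and off: "\<And>i i'. i \<in> U \<Longrightarrow> i' \<in> U \<Longrightarrow> i' \<noteq> i \<Longrightarrow>
      2 * nat \<bar>A i i'\<bar> \<le> off_weight (a i) * (of_bool (i' = j i) + of_bool (i' = k i))"
    and W: "\<And>W. W \<subseteq> U \<Longrightarrow> W \<noteq> {} \<Longrightarrow> j ` W = W \<Longrightarrow> \<exists>i\<in>W. a i = 2"
    and kernel: "\<And>v i. (\<And>i. i \<in> U \<Longrightarrow> (\<Sum>i'\<in>U. A i i' * v i') = 0) \<Longrightarrow> i \<in> U \<Longrightarrow> v i = (0::int)"
    and sol: "\<And>i. i \<in> U \<Longrightarrow> int p dvd (\<Sum>i'\<in>U. A i i' * x i')"
    and i: "i \<in> U"
  shows "int p dvd x i"
proof -
  define m where "m = card U"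
  obtain h where h: "bij_betw h {0..<m} U" using ex_bij_betw_nat_finite[OF U] m_def by auto
  define g where "g = inv_into {0..<m} h"
  have gh: "g (h i) = i" if "i < m" for i using h that by (simp add: g_def bij_betw_def)
  have hg: "h (g u) = u" "g u < m" if "u \<in> U" for u
    using h that bij_betw_inv_into_right[OF h that] bij_betw_inv_into[OF h]
    by (auto simp: g_def dest: bij_betwE)
  have hU: "h i \<in> U" if "i < m" for i using h that by (auto dest: bij_betwE)
  have hinj: "h i = h i' \<longleftrightarrow> i = i'" if "i < m" "i' < m" for i i' using gh that by metis
  define M where "M = mat m m (\<lambda>(i, i'). A (h i) (h i'))"
  have M: "M \<in> carrier_mat m m" by (simp add: M_def)
  have Mv: "(M *\<^sub>v v) $ i = (\<Sum>i'\<in>U. A (h i) i' * v $ g i')" if "v \<in> carrier_vec m" "i < m" for v i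
  proof -
    have "(M *\<^sub>v v) $ i = (\<Sum>i'\<in>{0..<m}. A (h i) (h i') * v $ g (h i'))"
      using that by (simp add: M_def scalar_prod_def gh)
    also have "\<dots> = (\<Sum>i'\<in>U. A (h i) i' * v $ g i')" by (rule sum.reindex_bij_betw[OF h])
    finally show ?thesis .
  qed
  have d0: "det M \<noteq> 0"
  proof
    assume "det M = 0"
    then obtain v where v: "v \<in> carrier_vec m" "v \<noteq> 0\<^sub>v m" "M *\<^sub>v v = 0\<^sub>v m"
      using det_0_iff_vec_prod_zero[OF M] by blast
    have "(\<Sum>i'\<in>U. A u i' * v $ g i') = 0" if "u \<in> U" for u
      using Mv[OF v(1) hg(2)[OF that]] v(3) hg[OF that] by simp
    then have "v $ g u = 0" if "u \<in> U" for u using kernel[of "\<lambda>u. v $ g u"] that by blast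
    then have "v $ i = 0" if "i < m" for i using gh[OF that] hU[OF that] by metis
    then have "v = 0\<^sub>v m" using v(1) by (intro eq_vecI) auto
    then show False using v(2) by simp
  qed
  have "\<bar>det M\<bar> \<le> int (3 ^ m)"
  proof -
    \<comment> \<open>A column outside \<open>U\<close> receives the index m, which no column of
      \<open>M\<close> has.\<close>
    define j' where "j' = (\<lambda>i. if j (h i) \<in> U then g (j (h i)) else m)"
    define k' where "k' = (\<lambda>i. if k (h i) \<in> U then g (k (h i)) else m)"
    have inv_iff: "i' = (if u \<in> U then g u else m) \<longleftrightarrow> h i' = u" if "i' < m" for i' u
      using hg[of u] gh[OF that] hU[OF that] that by auto
    have j'_iff: "i' = j' i \<longleftrightarrow> h i' = j (h i)" and k'_iff: "i' = k' i \<longleftrightarrow> h i' = k (h i)"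
      if "i' < m" for i i'
      unfolding j'_def k'_def by (rule inv_iff[OF that])+
    have "\<bar>det M\<bar> = \<bar>\<Sum>\<pi> | \<pi> permutes {0..<m}. signof \<pi> * (\<Prod>i=0..<m. M $$ (i, \<pi> i))\<bar>"
      by (simp add: det_def'[OF M])
    also have "\<dots> \<le> (\<Sum>\<pi> | \<pi> permutes {0..<m}. \<bar>signof \<pi> * (\<Prod>i=0..<m. M $$ (i, \<pi> i))\<bar>)"
      by (rule sum_abs)
    also have "\<dots> = (\<Sum>\<pi> | \<pi> permutes {0..<m}. int (\<Prod>i\<in>{0..<m}. nat \<bar>A (h i) (h (\<pi> i))\<bar>))"
    proof (rule sum.cong[OF refl])
      fix \<pi> assume "\<pi> \<in> {\<pi>. \<pi> permutes {0..<m}}"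
      then have "\<pi> i < m" if "i < m" for i using that permutes_in_image[of \<pi> "{0..<m}" i] by simp
      then have "(\<Prod>i=0..<m. M $$ (i, \<pi> i)) = (\<Prod>i=0..<m. A (h i) (h (\<pi> i)))"
        by (intro prod.cong) (auto simp: M_def)
      moreover have "\<bar>signof \<pi> :: int\<bar> = 1" by (simp add: sign_def)
      ultimately show "\<bar>signof \<pi> * (\<Prod>i=0..<m. M $$ (i, \<pi> i))\<bar> =
          int (\<Prod>i\<in>{0..<m}. nat \<bar>A (h i) (h (\<pi> i))\<bar>)"
        by (simp add: abs_mult abs_prod)
    qed
    also have "\<dots> = int (\<Sum>\<pi> | \<pi> permutes {0..<m}. \<Prod>i\<in>{0..<m}. nat \<bar>A (h i) (h (\<pi> i))\<bar>)"
      by simp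
    also have "\<dots> \<le> int (3 ^ card {0..<m})"
      unfolding of_nat_le_iff
    proof (rule permanent_bound[where a = "\<lambda>i. a (h i)" and j = j' and k = k'])
      show "a (h i) = 2 \<or> a (h i) = 3" "nat \<bar>A (h i) (h i)\<bar> \<le> a (h i)"
        if "i \<in> {0..<m}" for i using a[of "h i"] diag[of "h i"] hU that by auto
      show "j' i \<noteq> i" "k' i \<noteq> i" if "i \<in> {0..<m}" for i
        using j'_iff[of i i] k'_iff[of i i] jk[of "h i"] hU that by fastforce+
      show "j' i = k' i" if "i \<in> {0..<m}" "a (h i) = 3" for i
        using jk(3)[of "h i"] hU that by (auto simp: j'_def k'_def)
      show "2 * nat \<bar>A (h i) (h i')\<bar> \<le> off_weight (a (h i)) * (of_bool (i' = j' i) + of_bool (i' = k' i))"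
        if "i \<in> {0..<m}" "i' \<in> {0..<m}" "i' \<noteq> i" for i i'
        using off[of "h i" "h i'"] hU hinj j'_iff k'_iff that by simp
      show "\<exists>i\<in>W'. a (h i) = 2" if W': "W' \<subseteq> {0..<m}" "W' \<noteq> {}" "j' ` W' = W'" for W'
      proof -
        have "h (j' i) = j (h i)" if "i \<in> W'" for i
        proof -
          have "j' i \<in> W'" using W'(3) that by blast
          then have "j' i < m" "i < m" using W'(1) that by auto
          then show ?thesis using j'_iff by blast
        qed
        then have "j ` h ` W' = h ` j' ` W'" unfolding image_image by (intro image_cong) auto
        then have "j ` (h ` W') = h ` W'" using W'(3) by simp
        moreover have "h ` W' \<subseteq> U" using W' hU by auto
        ultimately show ?thesis using W[of "h ` W'"] W'(2) by blast
      qed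
    qed simp
    finally show ?thesis by simp
  qed
  moreover have "int (3 ^ m) < int p" using p(2) unfolding m_def by (simp only: of_nat_less_iff)
  ultimately have dp: "\<bar>det M\<bar> < int p" by (rule le_less_trans)
  define y where "y = vec m (\<lambda>i. x (h i))"
  have y: "y \<in> carrier_vec m" by (simp add: y_def)
  have yg: "y $ g u = x u" if "u \<in> U" for u using hg[OF that] by (simp add: y_def)
  have pM: "int p dvd (M *\<^sub>v y) $ i" if "i < m" for i
  proof -
    have "(M *\<^sub>v y) $ i = (\<Sum>i'\<in>U. A (h i) i' * x i')" using Mv[OF y that] yg by simp
    then show ?thesis using sol[OF hU[OF that]] by simp
  qed
  have "adj_mat M *\<^sub>v (M *\<^sub>v y) = (adj_mat M * M) *\<^sub>v y"
    using adj_mat(1)[OF M] M y by simp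
  also have "\<dots> = (det M \<cdot>\<^sub>m 1\<^sub>m m) *\<^sub>v y" using adj_mat(3)[OF M] by simp
  finally have eq: "adj_mat M *\<^sub>v (M *\<^sub>v y) = (det M \<cdot>\<^sub>m 1\<^sub>m m) *\<^sub>v y" .
  have gi: "g i < m" using hg(2)[OF i] .
  have "int p dvd (adj_mat M *\<^sub>v w) $ g i"
    if w: "w \<in> carrier_vec m" "\<And>l. l < m \<Longrightarrow> int p dvd w $ l" for w
  proof -
    have "(adj_mat M *\<^sub>v w) $ g i = (\<Sum>l\<in>{0..<m}. adj_mat M $$ (g i, l) * w $ l)"
      using adj_mat(1)[OF M] w(1) gi by (auto simp: scalar_prod_def)
    moreover have "int p dvd (\<Sum>l\<in>{0..<m}. adj_mat M $$ (g i, l) * w $ l)"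
      using w(2) by (intro dvd_sum dvd_mult) auto
    ultimately show ?thesis by simp
  qed
  then have "int p dvd (adj_mat M *\<^sub>v (M *\<^sub>v y)) $ g i"
    using pM M y by (metis mult_mat_vec_carrier)
  moreover have "((det M \<cdot>\<^sub>m 1\<^sub>m m) *\<^sub>v y) $ g i = det M * x i"
  proof -
    have "((det M \<cdot>\<^sub>m 1\<^sub>m m) *\<^sub>v y) $ g i =
        (\<Sum>l = 0..<m. det M * (if l = g i then 1 else 0) * y $ l)"
      using gi y by (simp add: scalar_prod_def)
    also have "\<dots> = (\<Sum>l = 0..<m. if l = g i then det M * y $ l else 0)"
      by (intro sum.cong) auto
    finally show ?thesis using gi yg[OF i] by simp
  qed
  ultimately have "int p dvd det M * x i" using eq by simp
  moreover have "\<not> int p dvd det M"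
  proof
    assume "int p dvd det M"
    then have "int p \<le> \<bar>det M\<bar>" using d0 by (metis abs_of_nat dvd_imp_le_int)
    then show False using dp by simp
  qed
  ultimately show ?thesis using p(1) prime_dvd_mult_iff[of "int p"] by auto
qed

lemma max_level_closed:
  fixes V :: "'a \<Rightarrow> int"
  assumes "finite T" "x \<in> T" "Y x \<in> T" "Z x \<in> T" "2 * V x = V (Y x) + V (Z x)" "V x = Max (V ` T)"
  shows "V (Y x) = Max (V ` T)" "V (Z x) = Max (V ` T)"
proof -
  have "V (Y x) \<le> Max (V ` T)" "V (Z x) \<le> Max (V ` T)" using assms by auto
  then show "V (Y x) = Max (V ` T)" "V (Z x) = Max (V ` T)" using assms(5,6) by linarith+
qed

text \<open>Differences to a base point \<open>x0\<close> solve the midpoint system modulo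
  \<open>p\<close>. On a minimal nonempty set closed under \<open>Y\<close> and \<open>Z\<close> the
  maximum principle makes the integer system nonsingular, so all points coincide with
  \<open>x0\<close> modulo \<open>p\<close>, although \<open>Y\<close> moves
  \<open>x0\<close>.\<close>

lemma no_midpoint_closed_set:
  fixes T :: "int set" and p :: nat and Y Z :: "int \<Rightarrow> int"
  assumes p: "prime p" "3 ^ card T < p" and T: "finite T" "T \<noteq> {}"
    and YZ: "\<And>x. x \<in> T \<Longrightarrow> Y x \<in> T \<and> Z x \<in> T \<and> Y x \<noteq> x \<and> Z x \<noteq> x \<and> [Y x + Z x = 2 * x] (mod int p)"
    and distinct: "\<And>x y. x \<in> T \<Longrightarrow> y \<in> T \<Longrightarrow> [x = y] (mod int p) \<Longrightarrow> x = y"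
  shows False
proof -
  define closed where "closed = (\<lambda>R. R \<subseteq> T \<and> R \<noteq> {} \<and> (\<forall>x\<in>R. Y x \<in> R \<and> Z x \<in> R))"
  have "closed T" using T YZ by (auto simp: closed_def)
  then obtain R where R: "closed R" and min: "\<And>R'. closed R' \<Longrightarrow> card R \<le> card R'"
    using ex_has_least_nat[of closed T card] by blast
  have RT: "R \<subseteq> T" "finite R" using R T finite_subset by (auto simp: closed_def)
  obtain x0 where x0: "x0 \<in> R" using R by (auto simp: closed_def)
  define U where "U = R - {x0}"
  have U: "finite U" "U \<subseteq> R" using RT by (auto simp: U_def)
  have YR: "Y x \<in> R" "Z x \<in> R" "Y x \<noteq> x" "Z x \<noteq> x" if "x \<in> R" for x
    using R YZ that RT by (auto simp: closed_def)
  define A where "A = (\<lambda>x x'. 2 * of_bool (x' = x) - of_bool (x' = Y x) - of_bool (x' = Z x) :: int)"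
  have sumA: "(\<Sum>x'\<in>U. A x x' * V x') = 2 * V x - V (Y x) - V (Z x)"
    if x: "x \<in> U" and V: "V x0 = 0" for V :: "int \<Rightarrow> int" and x
  proof -
    have "x \<in> R" using x U by blast
    have delta: "(\<Sum>x'\<in>U. of_bool (x' = y) * V x') = V y" if "y \<in> R" for y
      using that U V by (cases "y = x0") (auto simp: U_def of_bool_def if_distrib[of "\<lambda>c. c * _"] sum.delta' cong: if_cong intro!: sum.neutral)
    have "(\<Sum>x'\<in>U. A x x' * V x') = 2 * (\<Sum>x'\<in>U. of_bool (x' = x) * V x')
        - (\<Sum>x'\<in>U. of_bool (x' = Y x) * V x') - (\<Sum>x'\<in>U. of_bool (x' = Z x) * V x')"
      by (simp add: A_def left_diff_distrib sum_subtractf sum_distrib_left mult.assoc)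
    then show ?thesis using delta[OF \<open>x \<in> R\<close>] delta[OF YR(1)[OF \<open>x \<in> R\<close>]] delta[OF YR(2)[OF \<open>x \<in> R\<close>]] by simp
  qed
  \<comment> \<open>Discrete maximum principle: the set where a positive maximum is attained is
    closed and misses \<open>x0\<close>, against the minimality of \<open>R\<close>. Used for V and
    -V it gives V = 0.\<close>
  have nonpos: "V x \<le> 0" if V: "V x0 = 0" "\<And>x. x \<in> U \<Longrightarrow> 2 * V x = V (Y x) + V (Z x)" and x: "x \<in> R"
    for V :: "int \<Rightarrow> int" and x
  proof (rule ccontr)
    assume "\<not> V x \<le> 0"
    define \<mu> where "\<mu> = Max (V ` R)"
    have "V x \<le> \<mu>" using x RT by (auto simp: \<mu>_def)
    then have \<mu>: "\<mu> > 0" using \<open>\<not> V x \<le> 0\<close> by simp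
    define R' where "R' = {x\<in>R. V x = \<mu>}"
    have "\<mu> \<in> V ` R" unfolding \<mu>_def using RT x by (intro Max_in) auto
    then have "R' \<noteq> {}" by (auto simp: R'_def)
    moreover have "Y x \<in> R' \<and> Z x \<in> R'" if "x \<in> R'" for x
    proof -
      have xR: "x \<in> R" "V x = \<mu>" using that by (auto simp: R'_def)
      then have "x \<in> U" using V(1) \<mu> by (auto simp: U_def)
      then show ?thesis
        using max_level_closed[of R x Y Z V] RT(2) YR[OF xR(1)] V(2)[of x] xR
        by (simp add: R'_def \<mu>_def)
    qed
    ultimately have "closed R'" using RT by (auto simp: closed_def R'_def)
    then have "card R \<le> card R'" by (rule min)
    moreover have "x0 \<notin> R'" using V(1) \<mu> by (simp add: R'_def)
    then have "R' \<subset> R" using x0 by (auto simp: R'_def)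
    ultimately show False using RT psubset_card_mono[of R R'] by simp
  qed
  have "int p dvd x - x0" if "x \<in> U" for x
  \<comment> \<open>No signs are identified here, so every row has diagonal 2 and the condition on
    invariant sets is immediate.\<close>
  proof (rule mod_system_trivial[where A = A and U = U and a = "\<lambda>_. 2" and j = Y and k = Z and x = "\<lambda>x. x - x0"])
    show "prime p" by (rule p)
    have "card U \<le> card T" using U RT T by (intro card_mono) auto
    then have "(3::nat) ^ card U \<le> 3 ^ card T" by (intro power_increasing) auto
    then show "3 ^ card U < p" using p(2) by (rule le_less_trans)
    show "finite U" by (rule U)
    show "Y i \<noteq> i" "Z i \<noteq> i" if "i \<in> U" for i using YR U that by auto
    show "nat \<bar>A i i\<bar> \<le> 2" if "i \<in> U" for i using YR[of i] U that by (auto simp: A_def)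
    show "2 * nat \<bar>A i i'\<bar> \<le> off_weight 2 * (of_bool (i' = Y i) + of_bool (i' = Z i))"
      if "i' \<noteq> i" for i i' using that by (auto simp: A_def off_weight_def)
    show "v i = 0" if ker: "\<And>i. i \<in> U \<Longrightarrow> (\<Sum>i'\<in>U. A i i' * v i') = 0" and i: "i \<in> U" for v i
    proof -
      define V where "V = v(x0 := 0)"
      have V0: "V x0 = 0" by (simp add: V_def)
      have "(\<Sum>i'\<in>U. A x i' * V i') = (\<Sum>i'\<in>U. A x i' * v i')" for x
        by (intro sum.cong) (auto simp: V_def U_def)
      then have V2: "2 * V x = V (Y x) + V (Z x)" if "x \<in> U" for x
        using ker[OF that] sumA[OF that, of V] V0 by simp
      have "V i \<le> 0" using nonpos[of V i] V0 V2 i U by blast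
      moreover have "- V i \<le> 0" using nonpos[of "\<lambda>x. - V x" i] V0 V2 i U by fastforce
      ultimately show ?thesis using i by (auto simp: V_def U_def)
    qed
    show "int p dvd (\<Sum>i'\<in>U. A i i' * (i' - x0))" if "i \<in> U" for i
    proof -
      have "(\<Sum>i'\<in>U. A i i' * (i' - x0)) = 2 * i - (Y i + Z i)"
        using sumA[OF that, of "\<lambda>x. x - x0"] by simp
      moreover have "[2 * i = Y i + Z i] (mod int p)" using YZ[of i] that U RT by (auto simp: cong_sym)
      ultimately show ?thesis by (simp add: cong_iff_dvd_diff)
    qed
  qed (use that in auto)
  then have "x = x0" if "x \<in> U" for x
    using distinct[of x x0] that x0 U RT by (auto simp: cong_iff_dvd_diff)
  then have "U = {}" by (auto simp: U_def)
  then have "R = {x0}" using x0 by (auto simp: U_def)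
  then show False using YR[OF x0] by simp
qed

section \<open>Sums with a unique representation\<close>

lemma centered_residue_unique:
  assumes "[x = y] (mod int p)" "2 * \<bar>x\<bar> < int p" "2 * \<bar>y\<bar> < int p"
  shows "x = y"
proof -
  have "int p dvd x - y" using assms(1) by (simp add: cong_iff_dvd_diff)
  moreover have "\<bar>x - y\<bar> < int p" using assms(2,3) by linarith
  ultimately have "x - y = 0" using dvd_imp_le_int[of "x - y" "int p"] by auto
  then show ?thesis by simp
qed

text \<open>The number is positive and at most 3^m + 1 <= p, so divisibility would force p = 3^m +
  1, which is even.\<close>

lemma prime_dvd_pow3_pm1:
  fixes p s m :: nat and \<epsilon> :: int
  assumes p: "prime p" "3 ^ m < p" and s: "1 \<le> s" "s \<le> m" and e: "\<bar>\<epsilon>\<bar> = 1"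
    and dvd: "int p dvd 3 ^ s - \<epsilon>"
  shows False
proof -
  have p3: "p > 3"
  proof -
    have "(3::nat) ^ 1 \<le> 3 ^ m" using s by (intro power_increasing) auto
    then show ?thesis using p(2) by simp
  qed
  have "(3::int) ^ 1 \<le> 3 ^ s" using s by (intro power_increasing) auto
  then have pos: "3 ^ s - \<epsilon> > 0" using e by auto
  have "(3::int) ^ s \<le> 3 ^ m" using s by (intro power_increasing) auto
  moreover have mp: "(3::int) ^ m < int p" using p(2) by (metis of_nat_less_iff of_nat_numeral of_nat_power)
  moreover have "int p \<le> 3 ^ s - \<epsilon>" using dvd pos by (rule zdvd_imp_le)
  ultimately have "int p = 3 ^ m + 1" using e by linarith
  then have "even (int p)" by simp
  then show False using prime_odd_nat[OF p(1)] p3 by simp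
qed

text \<open>Otherwise every nonzero \<open>x \<in> S\<close> is the midpoint modulo \<open>p\<close> of two other elements \<open>Y x\<close>, \<open>Z x\<close> of
  \<open>S\<close>. Written in terms of the positive elements, these relations form a linear system to which
  \<open>mod_system_trivial\<close> applies unless its homogeneous integer version has a nonzero solution \<open>V\<close>. In that case
  the odd extension of \<open>V\<close> attains its maximum on a set closed under \<open>Y\<close> and \<open>Z\<close> with at
  most half as many elements as \<open>S\<close>.\<close>
lemma symmetric_set_unique_double:
  fixes S :: "int set" and p :: nat
  assumes p: "prime p" "3 ^ card {x\<in>S. x > 0} < p" and S: "finite S" "\<And>x. x \<in> S \<Longrightarrow> - x \<in> S"
    and range: "\<And>x. x \<in> S \<Longrightarrow> 2 * \<bar>x\<bar> < int p" and ne: "\<exists>x\<in>S. x \<noteq> 0"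
  shows "\<exists>x\<in>S. x \<noteq> 0 \<and> (\<forall>y\<in>S. \<forall>z\<in>S. [y + z = 2 * x] (mod int p) \<longrightarrow> y = x \<and> z = x)"
proof (rule ccontr)
  assume neg: "\<not> ?thesis"
  define U where "U = {x\<in>S. x > 0}"
  have U: "finite U" "\<And>x. x \<in> U \<Longrightarrow> x \<in> S \<and> x > 0" using S by (auto simp: U_def)
  have absU: "\<bar>x\<bar> \<in> U" if "x \<in> S" "x \<noteq> 0" for x
    using that S(2)[of x] by (auto simp: U_def abs_if)
  have Une: "U \<noteq> {}" using ne absU by blast
  have p3: "p > 3"
  proof -
    have "card U \<ge> 1" using U(1) Une card_gt_0_iff[of U] by (simp add: Suc_le_eq)
    then have "(3::nat) ^ 1 \<le> 3 ^ card U" by (intro power_increasing) auto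
    then show ?thesis using p(2) by (simp add: U_def)
  qed
  have inj: "x = y" if "[x = y] (mod int p)" "x \<in> S" "y \<in> S" for x y
    using centered_residue_unique that range by blast
  have nodvd: "\<not> int p dvd c * x" if "x \<in> S" "x \<noteq> 0" "0 < c" "c < int p" "coprime c (int p)" for c x
  proof
    assume "int p dvd c * x"
    then have "int p dvd x" using that(5) by (simp add: coprime_commute coprime_dvd_mult_right_iff)
    then have "int p \<le> \<bar>x\<bar>" using that(2) dvd_imp_le_int[of x "int p"] by auto
    then show False using range[OF that(1)] that(2) by linarith
  qed
  have podd: "odd p" using p(1) p3 prime_odd_nat[of p] by simp
  have cop4: "\<not> int p dvd 4 * x" if "x \<in> S" "x \<noteq> 0" for x
  proof -
    have "coprime (2 ^ 2) (int p)" using podd by (intro coprime_power_left_iff[THEN iffD2]) simp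
    moreover have "p \<noteq> 4" using podd by auto
    then have "p > 4" using p3 by simp
    ultimately show ?thesis using nodvd[OF that, of 4] by simp
  qed
  have cop3: "\<not> int p dvd 3 * x" if "x \<in> S" "x \<noteq> 0" for x
  proof -
    have "coprime 3 p" using p3 p(1) by (intro primes_coprime) auto
    then have "coprime (int 3) (int p)" by (simp only: coprime_int_iff)
    then show ?thesis using nodvd[OF that, of 3] p3 by simp
  qed
  have "\<exists>y z. y \<in> S \<and> z \<in> S \<and> [y + z = 2 * x] (mod int p) \<and> y \<noteq> x \<and> z \<noteq> x" if x: "x \<in> S" "x \<noteq> 0" for x
  proof -
    obtain y z where yz: "y \<in> S" "z \<in> S" "[y + z = 2 * x] (mod int p)" "\<not> (y = x \<and> z = x)"
      using neg x by blast
    have "z = x" if "y = x"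
      using yz that inj[OF _ yz(2) x(1)] by (simp add: cong_iff_dvd_diff algebra_simps)
    moreover have "y = x" if "z = x"
      using yz that inj[OF _ yz(1) x(1)] by (simp add: cong_iff_dvd_diff algebra_simps)
    ultimately show ?thesis using yz by blast
  qed
  then obtain y0 z0 where yz0: "\<And>x. x \<in> S \<Longrightarrow> x \<noteq> 0 \<Longrightarrow> y0 x \<in> S \<and> z0 x \<in> S \<and>
      [y0 x + z0 x = 2 * x] (mod int p) \<and> y0 x \<noteq> x \<and> z0 x \<noteq> x"
    by metis
  \<comment> \<open>The choice of midpoint partners is kept for positive x only and extended as an
    odd function, so that relations for x and -x agree.\<close>
  define Y where "Y = (\<lambda>x. if x > 0 then y0 x else - y0 (- x))"
  define Z where "Z = (\<lambda>x. if x > 0 then z0 x else - z0 (- x))"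
  have YZ: "Y x \<in> S \<and> Z x \<in> S \<and> [Y x + Z x = 2 * x] (mod int p) \<and> Y x \<noteq> x \<and> Z x \<noteq> x"
    if x: "x \<in> S" "x \<noteq> 0" for x
  proof (cases "x > 0")
    case True
    then show ?thesis using yz0[OF x] by (simp add: Y_def Z_def)
  next
    case False
    have "[- (y0 (- x) + z0 (- x)) = - (2 * - x)] (mod int p)"
      using yz0[of "- x"] x S(2) by (intro cong_uminus) auto
    then show ?thesis using False yz0[of "- x"] S(2) x by (auto simp: Y_def Z_def)
  qed
  have odd_YZ: "Y (- x) = - Y x" "Z (- x) = - Z x" if "x \<noteq> 0" for x
    using that by (auto simp: Y_def Z_def)
  \<comment> \<open>The row of 2 V(x) = V(Y x) + V(Z x) for an odd V, with columns indexed by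
    absolute values. A partner equal to 0 drops out because \<open>sgn 0 = 0\<close>.\<close>
  define A where "A = (\<lambda>x x'. 2 * of_bool (x' = x) - sgn (Y x) * of_bool (x' = \<bar>Y x\<bar>)
    - sgn (Z x) * of_bool (x' = \<bar>Z x\<bar>) :: int)"
  have sumA: "(\<Sum>x'\<in>U. A x x' * v x') = 2 * v x - sgn (Y x) * v \<bar>Y x\<bar> - sgn (Z x) * v \<bar>Z x\<bar>"
    if x: "x \<in> U" for v :: "int \<Rightarrow> int" and x
  proof -
    have delta: "(\<Sum>x'\<in>U. of_bool (x' = y) * v x') = v y" if "y \<in> U" for y
      using that U by (simp add: of_bool_def if_distrib[of "\<lambda>c. c * _"] cong: if_cong)
    have delta': "sgn y * (\<Sum>x'\<in>U. of_bool (x' = \<bar>y\<bar>) * v x') = sgn y * v \<bar>y\<bar>" if "y \<in> S" for y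
      using delta[OF absU[OF that]] by (cases "y = 0") auto
    have "(\<Sum>x'\<in>U. A x x' * v x') = 2 * (\<Sum>x'\<in>U. of_bool (x' = x) * v x')
        - sgn (Y x) * (\<Sum>x'\<in>U. of_bool (x' = \<bar>Y x\<bar>) * v x') - sgn (Z x) * (\<Sum>x'\<in>U. of_bool (x' = \<bar>Z x\<bar>) * v x')"
      by (simp add: A_def left_diff_distrib sum_subtractf sum_distrib_left mult.assoc)
    then show ?thesis using YZ[of x] U(2)[OF x] delta[OF x] delta' by simp
  qed
  show False
  proof (cases "\<exists>v. (\<forall>x\<in>U. (\<Sum>x'\<in>U. A x x' * v x') = 0) \<and> (\<exists>x\<in>U. v x \<noteq> (0::int))")
    case False
    \<comment> \<open>If one partner is -x, its entry falls on the diagonal and raises it from 2 to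
      3. The other partner is then the only column left, and \<open>j\<close> and \<open>k\<close>
      both name it.\<close>
    define a where "a = (\<lambda>x. if Y x = - x \<or> Z x = - x then 3 else 2 :: nat)"
    define j where "j = (\<lambda>x. if Y x = - x then \<bar>Z x\<bar> else \<bar>Y x\<bar>)"
    define k where "k = (\<lambda>x. if Z x = - x then \<bar>Y x\<bar> else \<bar>Z x\<bar>)"
    have notboth: "\<not> (Y x = - x \<and> Z x = - x)" if "x \<in> U" for x
    proof
      assume "Y x = - x \<and> Z x = - x"
      then have "[2 * x = - x + - x] (mod int p)" using YZ[of x] U(2)[OF that] by (auto simp: cong_sym)
      then have "int p dvd 4 * x" by (simp add: cong_iff_dvd_diff)
      then show False using cop4[of x] U(2)[OF that] by simp
    qed
    have abs_iff: "\<bar>y\<bar> = x \<longleftrightarrow> y = x \<or> y = - x" if "x \<in> U" for x y :: int using U(2)[OF that] by auto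
    have "int p dvd x" if "x \<in> U" for x
    proof (rule mod_system_trivial[where A = A and U = U and a = a and j = j and k = k and x = "\<lambda>x. x"])
      show "prime p" by (rule p)
      show "3 ^ card U < p" using p(2) by (simp add: U_def)
      show "finite U" by (rule U)
      show "a i = 2 \<or> a i = 3" for i by (simp add: a_def)
      fix i assume i: "i \<in> U"
      have iS: "i \<in> S" "i > 0" "i \<noteq> 0" using U(2)[OF i] by auto
      note YZi = YZ[OF iS(1,3)]
      show "j i \<noteq> i" "k i \<noteq> i"
        using YZi notboth[OF i] abs_iff[OF i] by (auto simp: j_def k_def)
      show "j i = k i" if "a i = 3" using that notboth[OF i] by (auto simp: j_def k_def a_def split: if_splits)
      show "nat \<bar>A i i\<bar> \<le> a i"
        using YZi notboth[OF i] iS by (auto simp: A_def a_def)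
      show "2 * nat \<bar>A i i'\<bar> \<le> off_weight (a i) * (of_bool (i' = j i) + of_bool (i' = k i))"
        if ne: "i' \<noteq> i" for i'
      proof -
        define s t where "s = (of_bool (i' = \<bar>Y i\<bar>) :: nat)" and "t = (of_bool (i' = \<bar>Z i\<bar>) :: nat)"
        have "\<bar>A i i'\<bar> \<le> \<bar>sgn (Y i) * int s\<bar> + \<bar>sgn (Z i) * int t\<bar>"
          using ne by (simp add: A_def s_def t_def abs_triangle_ineq4)
        also have "\<dots> \<le> 1 * int s + 1 * int t"
          unfolding abs_mult by (intro add_mono mult_mono) (auto simp: sgn_if)
        finally have le: "nat \<bar>A i i'\<bar> \<le> s + t" by simp
        consider "Y i = - i" | "Y i \<noteq> - i" "Z i = - i" | "Y i \<noteq> - i" "Z i \<noteq> - i" by blast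
        then show ?thesis
        proof cases
          case 1
          then have "s = 0" using ne iS by (simp add: s_def)
          then show ?thesis using 1 le notboth[OF i] by (simp add: a_def off_weight_def j_def k_def t_def)
        next
          case 2
          then have "t = 0" using ne iS by (simp add: t_def)
          then show ?thesis using 2 le by (simp add: a_def off_weight_def j_def k_def s_def)
        next
          case 3
          then show ?thesis using le by (simp add: a_def off_weight_def j_def k_def s_def t_def)
        qed
      qed
      show "int p dvd (\<Sum>i'\<in>U. A i i' * i')"
      proof -
        have "(\<Sum>i'\<in>U. A i i' * i') = 2 * i - (Y i + Z i)"
          using sumA[OF i, of "\<lambda>x. x"] by (simp add: mult_sgn_abs)
        moreover have "[2 * i = Y i + Z i] (mod int p)" using YZi by (auto simp: cong_sym)
        ultimately show ?thesis by (simp add: cong_iff_dvd_diff)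
      qed
    next
      show "v i = 0" if "\<And>i. i \<in> U \<Longrightarrow> (\<Sum>i'\<in>U. A i i' * v i') = 0" "i \<in> U" for v i
        using that False by blast
    next
      fix W assume W: "W \<subseteq> U" "W \<noteq> {}" "j ` W = W"
      show "\<exists>i\<in>W. a i = 2"
      proof (rule ccontr)
        assume "\<not> (\<exists>i\<in>W. a i = 2)"
        moreover have "a i = 2 \<or> a i = 3" for i by (simp add: a_def)
        ultimately have a3: "a i = 3" if "i \<in> W" for i using that by blast
        \<comment> \<open>With one partner equal to -i the relation reads 3 i = z modulo
          \<open>p\<close>. As \<open>j\<close> permutes \<open>W\<close>, multiplying over
          \<open>W\<close> cancels the product of its elements and leaves 3 ^ card W congruent to 1
          or -1.\<close>
        have "\<exists>\<epsilon>. \<bar>\<epsilon>\<bar> = 1 \<and> [3 * i = \<epsilon> * j i] (mod int p)" if iW: "i \<in> W" for i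
        proof -
          have i: "i \<in> U" "i \<in> S" "i \<noteq> 0" using iW W U(2)[of i] by auto
          obtain z where z: "j i = \<bar>z\<bar>" "[- i + z = 2 * i] (mod int p)"
            using a3[OF iW] YZ[OF i(2,3)] notboth[OF i(1)]
            by (auto simp: a_def j_def add.commute split: if_splits)
          have "[3 * i = z] (mod int p)"
            using cong_sym[OF z(2)] by (simp add: cong_iff_dvd_diff algebra_simps)
          moreover have "z = (if z < 0 then - 1 else 1) * j i" by (simp add: z(1))
          ultimately show ?thesis by (intro exI[of _ "if z < 0 then - 1 else 1"]) auto
        qed
        then obtain e where e: "\<And>i. i \<in> W \<Longrightarrow> \<bar>e i\<bar> = 1" "\<And>i. i \<in> W \<Longrightarrow> [3 * i = e i * j i] (mod int p)"
          by metis
        have finW: "finite W" using W U finite_subset by blast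
        have injW: "inj_on j W" using W finW by (intro eq_card_imp_inj_on) auto
        define \<epsilon> where "\<epsilon> = (\<Prod>i\<in>W. e i)"
        define Q where "Q = (\<Prod>i\<in>W. i)"
        have "(\<Prod>i\<in>W. j i) = (\<Prod>i\<in>j ` W. i)" using injW by (simp add: prod.reindex)
        then have "(\<Prod>i\<in>W. j i) = Q" by (simp add: W(3) Q_def)
        moreover have "[(\<Prod>i\<in>W. 3 * i) = (\<Prod>i\<in>W. e i * j i)] (mod int p)" by (intro cong_prod e)
        ultimately have "[3 ^ card W * Q = \<epsilon> * Q] (mod int p)"
          by (simp add: prod.distrib Q_def \<epsilon>_def)
        then have "int p dvd (3 ^ card W - \<epsilon>) * Q" by (simp add: cong_iff_dvd_diff left_diff_distrib)
        moreover have "\<not> int p dvd Q"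
        proof
          assume "int p dvd Q"
          then obtain i where "i \<in> W" "int p dvd i"
            unfolding Q_def using prime_dvd_prod_iff[OF finW, of "int p" "\<lambda>i. i"] p(1) by auto
          then show False using nodvd[of i 1] W U(2)[of i] p3 by auto
        qed
        ultimately have "int p dvd 3 ^ card W - \<epsilon>" using p(1) prime_dvd_mult_iff[of "int p"] by auto
        moreover have "\<bar>\<epsilon>\<bar> = 1" using e(1) by (simp add: \<epsilon>_def abs_prod)
        moreover have "card W \<le> card U" using W U by (intro card_mono) auto
        moreover have "1 \<le> card W" using finW W(2) card_gt_0_iff[of W] by (simp add: Suc_le_eq)
        ultimately show False using prime_dvd_pow3_pm1[of p "card U" "card W" \<epsilon>] p by (simp add: U_def)
      qed
    qed (use that in auto)
    then show False using Une nodvd[of _ 1] U(2) p3 by auto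
  next
    case True
    then obtain v u where v: "\<And>x. x \<in> U \<Longrightarrow> (\<Sum>x'\<in>U. A x x' * v x') = 0" and u: "u \<in> U" "v u \<noteq> 0"
      by blast
    define V where "V = (\<lambda>x. sgn x * v \<bar>x\<bar>)"
    have V_odd: "V (- x) = - V x" for x by (simp add: V_def sgn_minus)
    have V2U: "2 * V x = V (Y x) + V (Z x)" if "x \<in> U" for x
      using v[OF that] sumA[OF that, of v] U(2)[OF that] by (simp add: V_def)
    have V2: "2 * V x = V (Y x) + V (Z x)" if x: "x \<in> S" "x \<noteq> 0" for x
    proof (cases "x > 0")
      case True
      then show ?thesis using V2U[of x] x by (simp add: U_def)
    next
      case False
      then have "- x \<in> U" using absU[OF x] by simp
      then show ?thesis using V2U[of "- x"] V_odd odd_YZ[OF x(2)] by simp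
    qed
    define \<mu> where "\<mu> = Max (V ` S)"
    have le: "V x \<le> \<mu>" if "x \<in> S" for x using that S by (simp add: \<mu>_def)
    have "V u \<noteq> 0" using u U(2)[OF u(1)] by (simp add: V_def)
    then have \<mu>: "\<mu> > 0" using le[of u] le[of "- u"] V_odd[of u] U(2)[OF u(1)] S(2)[of u] by auto
    define T where "T = {x\<in>S. V x = \<mu>}"
    have T0: "x \<in> S" "x \<noteq> 0" "V x = \<mu>" if "x \<in> T" for x
      using that \<mu> by (auto simp: T_def V_def)
    have closed: "Y x \<in> T \<and> Z x \<in> T" if "x \<in> T" for x
      using max_level_closed[of S x Y Z V] S(1) YZ[OF T0(1,2)[OF that]] V2[OF T0(1,2)[OF that]] T0[OF that]
      by (simp add: T_def \<mu>_def)
    \<comment> \<open>\<open>T\<close> never contains both x and -x, since V is odd and \<mu> is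
      positive.\<close>
    have "card T \<le> card U"
    proof (rule card_inj_on_le)
      show "inj_on abs T"
      proof (rule inj_onI)
        fix x y assume xy: "x \<in> T" "y \<in> T" "\<bar>x\<bar> = \<bar>y\<bar>"
        then have "x = y \<or> x = - y" by linarith
        moreover have "x \<noteq> - y" using T0(3)[OF xy(1)] T0(3)[OF xy(2)] V_odd[of y] \<mu> by auto
        ultimately show "x = y" by blast
      qed
      show "abs ` T \<subseteq> U" using absU T0 by auto
    qed (rule U)
    then have "(3::nat) ^ card T \<le> 3 ^ card U" by (intro power_increasing) auto
    moreover have "(3::nat) ^ card U < p" using p(2) by (simp add: U_def)
    ultimately have pT: "3 ^ card T < p" by (rule le_less_trans)
    have "\<mu> \<in> V ` S" unfolding \<mu>_def using S u U(2) by (intro Max_in) auto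
    then have "T \<noteq> {}" by (auto simp: T_def)
    show False
    proof (rule no_midpoint_closed_set[OF p(1) pT])
      show "finite T" using S(1) by (simp add: T_def)
      show "T \<noteq> {}" by fact
      show "Y x \<in> T \<and> Z x \<in> T \<and> Y x \<noteq> x \<and> Z x \<noteq> x \<and> [Y x + Z x = 2 * x] (mod int p)"
        if "x \<in> T" for x
        using closed[OF that] YZ[OF T0(1,2)[OF that]] by blast
      show "x = y" if "x \<in> T" "y \<in> T" "[x = y] (mod int p)" for x y
        using inj[OF that(3)] T0(1) that by blast
    qed
  qed
qed

section \<open>Symmetry of the support\<close>

context
  fixes p r :: nat
  assumes p: "prime p" and r: "r > 0" and pr: "coprime p r"
begin

text \<open>The two coefficient sequences differ by a constant. Small supports leave an index where
  both vanish, so this constant is 0.\<close>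

lemma sparse_expansion_unique:
  assumes a: "\<And>i. a i \<in> int_adjoin (zeta r)" and b: "\<And>i. b i \<in> int_adjoin (zeta r)"
    and eq: "(\<Sum>i<p. a i * zeta p ^ i) = (\<Sum>i<p. b i * zeta p ^ i)"
    and small: "card {i. i < p \<and> a i \<noteq> 0} + card {i. i < p \<and> b i \<noteq> 0} < p"
    and i: "i < p"
  shows "a i = b i"
proof -
  have "card ({i. i < p \<and> a i \<noteq> 0} \<union> {i. i < p \<and> b i \<noteq> 0}) < card {..<p}"
    using card_Un_le[of "{i. i < p \<and> a i \<noteq> 0}" "{i. i < p \<and> b i \<noteq> 0}"] small by simp
  then have "\<not> {..<p} \<subseteq> {i. i < p \<and> a i \<noteq> 0} \<union> {i. i < p \<and> b i \<noteq> 0}"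
    using card_mono[of "{i. i < p \<and> a i \<noteq> 0} \<union> {i. i < p \<and> b i \<noteq> 0}" "{..<p}"] by fastforce
  then obtain l where l: "l < p" "a l = 0" "b l = 0" by blast
  have "(\<Sum>i<p. (a i - b i) * zeta p ^ i) = 0"
    using eq by (simp add: left_diff_distrib sum_subtractf)
  then have "a i - b i = a l - b l"
    using expansion_unique[OF p r pr, of "\<lambda>i. a i - b i" i l] a b i l by (simp add: int_adjoin_diff)
  then show ?thesis using l by simp
qed

lemma monomial_if_card_le_1:
  assumes "X = (\<Sum>i<p. b i * zeta p ^ i)" "card {i. i < p \<and> b i \<noteq> (0::complex)} \<le> 1"
  obtains i where "i < p" "X = b i * zeta p ^ i"
proof -
  have p0: "p > 0" using p prime_gt_0_nat by blast
  obtain i where i: "i < p" "{i. i < p \<and> b i \<noteq> 0} \<subseteq> {i}"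
  proof (cases "{i. i < p \<and> b i \<noteq> 0} = {}")
    case True
    then have "{i. i < p \<and> b i \<noteq> 0} \<subseteq> {0}" by blast
    then show ?thesis using that[of 0] p0 by blast
  next
    case False
    then obtain i where i: "i < p" "b i \<noteq> 0" by blast
    have "{i. i < p \<and> b i \<noteq> 0} \<subseteq> {i}"
    proof
      fix j assume "j \<in> {i. i < p \<and> b i \<noteq> 0}"
      then have "card {i, j} \<le> 1"
        using card_mono[of "{i. i < p \<and> b i \<noteq> 0}" "{i, j}"] i assms(2) by auto
      then show "j \<in> {i}" by (cases "i = j") auto
    qed
    then show ?thesis using that i by blast
  qed
  have "X = (\<Sum>j\<in>{i}. b j * zeta p ^ j)"
    unfolding assms(1) using i by (intro sum.mono_neutral_right) auto
  then show ?thesis using that i by simp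
qed

lemma sum_reindex_mod_p:
  fixes f :: "nat \<Rightarrow> complex"
  assumes "\<And>i. i < p \<Longrightarrow> s (t i) = i" "\<And>i. i < p \<Longrightarrow> t (s i) = i"
    "\<And>i. i < p \<Longrightarrow> s i < p" "\<And>i. i < p \<Longrightarrow> t i < p"
  shows "(\<Sum>i<p. f i * zeta p ^ s i) = (\<Sum>i<p. f (t i) * zeta p ^ i)"
  by (rule sum.reindex_bij_witness[of _ t s]) (use assms in auto)

text \<open>The automorphism inverts \<open>\<zeta>\<^sub>p\<close> and multiplies \<open>Y\<close> by \<open>\<epsilon>\<close>, which itself has a single
  term \<open>e \<zeta>\<^sub>p ^ c\<close>. Comparing supports of both sides gives the reflection symmetry.\<close>
lemma support_reflection:
  assumes k: "coprime k (p * r)" "[k + 1 = 0] (mod p)"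
    and b: "\<And>i. b i \<in> int_adjoin (zeta r)" and Y: "Y = (\<Sum>i<p. b i * zeta p ^ i)"
    and small: "2 * card {i. i < p \<and> b i \<noteq> 0} < p"
    and eps: "gal (p * r) k Y = e * zeta p ^ c * Y" "e \<in> int_adjoin (zeta r)" "c < p"
    and i: "i < p" "b i \<noteq> 0"
  shows "b ((2 * p - i - c) mod p) \<noteq> 0"
proof -
  have p0: "p > 0" using p prime_gt_0_nat by blast
  have kr: "coprime k r" using k by simp
  define g where "g = (\<lambda>i. gal r k (b i))"
  have g: "g i \<in> int_adjoin (zeta r)" "g i = 0 \<longleftrightarrow> b i = 0" for i
    using gal_in_int_adjoin[OF r kr b] gal_eq_0_iff[OF r kr b] by (simp_all add: g_def)
  \<comment> \<open>\<open>neg\<close>, \<open>sh\<close> and \<open>shm\<close> are i -> -i, i -> i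
    + c and i -> i - c on residues below \<open>p\<close>, written without truncated
    subtraction.\<close>
  define neg where "neg = (\<lambda>i. (p - i) mod p)"
  define sh where "sh = (\<lambda>i. (i + c) mod p)"
  define shm where "shm = (\<lambda>i. (i + (p - c)) mod p)"
  have neg: "neg (neg i) = i" "neg i < p" if "i < p" for i
    using that p0 by (cases "i = 0"; simp add: neg_def)+
  have sh: "sh (shm i) = i" "shm (sh i) = i" if "i < p" for i
  proof -
    have "sh (shm i) = (i + (p - c) + c) mod p" by (simp add: sh_def shm_def mod_simps)
    also have "i + (p - c) + c = i + p" using eps(3) by simp
    finally show "sh (shm i) = i" using that by simp
    have "shm (sh i) = (i + c + (p - c)) mod p" by (simp add: sh_def shm_def mod_simps)
    also have "i + c + (p - c) = i + p" using eps(3) by simp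
    finally show "shm (sh i) = i" using that by simp
  qed
  have shp: "sh i < p" "shm i < p" for i using p0 by (auto simp: sh_def shm_def)
  have zneg: "zeta p ^ (k * i) = zeta p ^ neg i" if "i < p" for i
  proof -
    have "[(k + 1) * i + (p - i) = 0 * i + (p - i)] (mod p)"
      by (intro cong_add cong_mult k cong_refl)
    moreover have "(k + 1) * i + (p - i) = k * i + p" using that by simp
    ultimately have "[k * i + p = p - i] (mod p)" by simp
    then have "[k * i = neg i] (mod p)" by (simp add: cong_def neg_def)
    then show ?thesis by (rule zeta_power_cong[OF p0])
  qed
  have "gal (p * r) k Y = (\<Sum>i<p. g i * zeta p ^ neg i)"
    unfolding Y gal_expansion[OF p r pr k(1) b] g_def by (simp add: zneg)
  also have "\<dots> = (\<Sum>i<p. g (neg i) * zeta p ^ i)"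
    using neg by (intro sum_reindex_mod_p) auto
  finally have lhs: "gal (p * r) k Y = (\<Sum>i<p. g (neg i) * zeta p ^ i)" .
  have "e * zeta p ^ c * Y = (\<Sum>i<p. (e * b i) * zeta p ^ sh i)"
    unfolding Y sh_def by (simp add: sum_distrib_left zeta_power_mod[OF p0] power_add mult_ac)
  also have "\<dots> = (\<Sum>i<p. (e * b (shm i)) * zeta p ^ i)"
    using sh shp by (intro sum_reindex_mod_p[where f = "\<lambda>i. e * b i"]) auto
  finally have rhs: "e * zeta p ^ c * Y = (\<Sum>i<p. (e * b (shm i)) * zeta p ^ i)" .
  have card1: "card {i. i < p \<and> g (neg i) \<noteq> 0} \<le> card {i. i < p \<and> b i \<noteq> 0}"
    using neg g by (intro card_inj_on_le[of neg] inj_onI) (auto, metis)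
  have card2: "card {i. i < p \<and> e * b (shm i) \<noteq> 0} \<le> card {i. i < p \<and> b i \<noteq> 0}"
    using sh shp by (intro card_inj_on_le[of shm] inj_onI) (auto, metis)
  have "g (neg (neg i)) = e * b (shm (neg i))"
  proof (rule sparse_expansion_unique[where a = "\<lambda>i. g (neg i)" and b = "\<lambda>i. e * b (shm i)"])
    show "(\<Sum>i<p. g (neg i) * zeta p ^ i) = (\<Sum>i<p. e * b (shm i) * zeta p ^ i)"
      using lhs rhs eps(1) by simp
    show "card {i. i < p \<and> g (neg i) \<noteq> 0} + card {i. i < p \<and> e * b (shm i) \<noteq> 0} < p"
      using card1 card2 small by linarith
  qed (use g neg i eps b int_adjoin_mult in auto)
  then have "b (shm (neg i)) \<noteq> 0" using i g neg by auto
  moreover have "shm (neg i) = (2 * p - i - c) mod p"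
  proof -
    have "shm (neg i) = (p - i + (p - c)) mod p" by (simp add: neg_def shm_def mod_simps)
    moreover have "p - i + (p - c) = 2 * p - i - c" using i eps(3) by simp
    ultimately show ?thesis by simp
  qed
  ultimately show ?thesis by simp
qed

text \<open>The sum is the coefficient at \<open>zeta p ^ k\<close> in the expansion of Y * cnj Y.
  That expansion has at most (card S)^2 nonzero coefficients, so it can be compared with the
  one-term expansion of n.\<close>

lemma correlation_zero:
  assumes b: "\<And>i. b i \<in> int_adjoin (zeta r)" and Y: "Y = (\<Sum>i<p. b i * zeta p ^ i)"
    and n: "Y * cnj Y = of_nat n" and small: "(card {i. i < p \<and> b i \<noteq> 0})\<^sup>2 + 1 < p"
    and k: "0 < k" "k < p"
  shows "(\<Sum>(i, j) | i < p \<and> j < p \<and> b i \<noteq> 0 \<and> b j \<noteq> 0 \<and> (i + (p - j)) mod p = k. b i * cnj (b j)) = 0"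
proof -
  have p0: "p > 0" using p prime_gt_0_nat by blast
  define S where "S = {i. i < p \<and> b i \<noteq> 0}"
  have S: "finite S" "\<And>i. i \<in> S \<Longrightarrow> i < p" by (auto simp: S_def)
  define C where "C = (\<lambda>k. \<Sum>x\<in>{x\<in>S \<times> S. (fst x + (p - snd x)) mod p = k}. b (fst x) * cnj (b (snd x)))"
  have YS: "Y = (\<Sum>i\<in>S. b i * zeta p ^ i)"
    unfolding Y S_def by (intro sum.mono_neutral_right) auto
  have "of_nat n = (\<Sum>x\<in>S \<times> S. b (fst x) * cnj (b (snd x)) * zeta p ^ ((fst x + (p - snd x)) mod p))"
  proof -
    have "of_nat n = (\<Sum>i\<in>S. \<Sum>j\<in>S. b i * cnj (b j) * (zeta p ^ (i * 1) * cnj (zeta p ^ (j * 1))))"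
      unfolding n[symmetric] YS by (simp add: sum_product mult_ac)
    also have "\<dots> = (\<Sum>i\<in>S. \<Sum>j\<in>S. b i * cnj (b j) * zeta p ^ ((i + (p - j)) mod p))"
    proof (intro sum.cong refl)
      fix i j assume "i \<in> S" "j \<in> S"
      then have "zeta p ^ (i * 1) * cnj (zeta p ^ (j * 1)) = zeta p ^ (1 * (i + (p - j)))"
        using S by (intro zeta_conj_product p0) (simp add: less_imp_le)
      then show "b i * cnj (b j) * (zeta p ^ (i * 1) * cnj (zeta p ^ (j * 1))) =
          b i * cnj (b j) * zeta p ^ ((i + (p - j)) mod p)"
        by (simp add: zeta_power_mod[OF p0])
    qed
    finally show ?thesis by (simp add: sum.cartesian_product case_prod_beta)
  qed
  also have "\<dots> = (\<Sum>k<p. \<Sum>x\<in>{x\<in>S \<times> S. (fst x + (p - snd x)) mod p = k}.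
      b (fst x) * cnj (b (snd x)) * zeta p ^ ((fst x + (p - snd x)) mod p))"
    using S p0 by (intro sum.group[symmetric]) auto
  also have "\<dots> = (\<Sum>k<p. C k * zeta p ^ k)"
    unfolding C_def by (intro sum.cong refl) (simp add: sum_distrib_right)
  finally have e1: "(\<Sum>k<p. C k * zeta p ^ k) = of_nat n" by simp
  have e2: "(\<Sum>k<p. (if k = 0 then of_nat n else 0) * zeta p ^ k) = of_nat n"
  proof -
    have "(\<Sum>k<p. (if k = 0 then of_nat n else 0) * zeta p ^ k) = (\<Sum>k<p. if k = 0 then of_nat n else 0)"
      by (intro sum.cong) auto
    then show ?thesis using p0 by simp
  qed
  have "C k = (if k = 0 then of_nat n else 0)"
  proof (rule sparse_expansion_unique[where a = C and b = "\<lambda>k. if k = 0 then of_nat n else 0"])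
    show "C i \<in> int_adjoin (zeta r)" for i
      unfolding C_def by (intro int_adjoin_sum int_adjoin_mult int_adjoin_cnj r b)
    show "(if i = 0 then of_nat n else 0) \<in> int_adjoin (zeta r)" for i :: nat
      using int_adjoin_of_int[of "int n"] int_adjoin_0 by simp
    have "{i. i < p \<and> C i \<noteq> 0} \<subseteq> (\<lambda>x. (fst x + (p - snd x)) mod p) ` (S \<times> S)"
    proof
      fix i assume "i \<in> {i. i < p \<and> C i \<noteq> 0}"
      then have "C i \<noteq> 0" by simp
      then have "{x\<in>S \<times> S. (fst x + (p - snd x)) mod p = i} \<noteq> {}"
        unfolding C_def by (metis (no_types, lifting) sum.empty)
      then show "i \<in> (\<lambda>x. (fst x + (p - snd x)) mod p) ` (S \<times> S)" by blast
    qed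
    then have "card {i. i < p \<and> C i \<noteq> 0} \<le> card (S \<times> S)"
      using S by (intro surj_card_le) auto
    then have "card {i. i < p \<and> C i \<noteq> 0} \<le> (card S)\<^sup>2"
      by (simp add: card_cartesian_product power2_eq_square)
    moreover have "card {i. i < p \<and> (if i = 0 then of_nat n else 0) \<noteq> (0::complex)} \<le> card {0::nat}"
      by (intro card_mono) (auto split: if_splits)
    ultimately show "card {i. i < p \<and> C i \<noteq> 0} +
        card {i. i < p \<and> (if i = 0 then of_nat n else 0) \<noteq> (0::complex)} < p"
      using small by (simp add: S_def)
  qed (use e1 e2 k in auto)
  then have "C k = 0" using k by simp
  moreover have "{x\<in>S \<times> S. (fst x + (p - snd x)) mod p = k} =
      {(i, j). i < p \<and> j < p \<and> b i \<noteq> 0 \<and> b j \<noteq> 0 \<and> (i + (p - j)) mod p = k}"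
    by (auto simp: S_def)
  ultimately show ?thesis by (simp add: C_def case_prod_beta)
qed

end

section \<open>Centered residues, the order of \<open>q\<close>, and the conclusion\<close>

lemma centered_residue:
  fixes p :: nat
  assumes "odd p"
  obtains cr :: "int \<Rightarrow> int" where "\<And>x. [cr x = x] (mod int p)" "\<And>x. 2 * \<bar>cr x\<bar> < int p"
proof -
  obtain m where m: "p = 2 * m + 1" using assms by (rule oddE)
  define cr where "cr = (\<lambda>x::int. (x + int m) mod int p - int m)"
  have "[cr x = x] (mod int p)" for x
  proof -
    have "[(x + int m) mod int p - int m = x + int m - int m] (mod int p)"
      by (intro cong_diff) (simp_all add: cong_def)
    then show ?thesis by (simp add: cr_def)
  qed
  moreover have "2 * \<bar>cr x\<bar> < int p" for x
  proof -
    define t where "t = (x + int m) mod int p"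
    have "0 \<le> t" "t < int p" "int p = 2 * int m + 1" using m by (simp_all add: t_def)
    then have "2 * \<bar>t - int m\<bar> < int p" by arith
    then show ?thesis by (simp add: cr_def t_def)
  qed
  ultimately show ?thesis using that by blast
qed

lemma two_card_positive_le:
  fixes S :: "int set"
  assumes "finite S" "\<And>x. x \<in> S \<Longrightarrow> - x \<in> S"
  shows "2 * card {x\<in>S. x > 0} \<le> card S"
proof -
  have "card {x\<in>S. x > 0} \<le> card {x\<in>S. x < 0}"
    using assms by (intro card_inj_on_le[of uminus]) auto
  moreover have "card {x\<in>S. x > 0} + card {x\<in>S. x < 0} = card ({x\<in>S. x > 0} \<union> {x\<in>S. x < 0})"
    using assms(1) by (intro card_Un_disjoint[symmetric]) auto
  moreover have "\<dots> \<le> card S" using assms(1) by (intro card_mono) auto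
  ultimately show ?thesis by linarith
qed

text \<open>Modulo the prime \<open>p\<close> the half power squares to 1, and by minimality of the
  order it is not 1 itself.\<close>

lemma power_half_order:
  fixes p q :: nat
  assumes p: "prime p" and q: "coprime q p" and even: "even (ord p q)"
  shows "[q ^ (ord p q div 2) + 1 = 0] (mod p)"
proof -
  define h where "h = ord p q div 2"
  have o: "ord p q = 2 * h" using even by (simp add: h_def)
  have "ord p q > 0" using q by (simp add: coprime_commute ord_eq_0 gr0I)
  then have h: "0 < h" "h < ord p q" using o by auto
  have "[q ^ (2 * h) = 1] (mod p)" using ord[of q p] o by simp
  then have "[int q ^ (2 * h) = 1] (mod int p)" by (metis cong_int_iff of_nat_1 of_nat_power)
  then have "int p dvd (int q ^ h - 1) * (int q ^ h + 1)"
    by (simp add: cong_iff_dvd_diff power_mult mult.commute[of 2] algebra_simps power2_eq_square)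
  then consider "int p dvd int q ^ h - 1" | "int p dvd int q ^ h + 1"
    using p prime_dvd_mult_iff[of "int p"] by auto
  then show ?thesis
  proof cases
    case 1
    then have "[int (q ^ h) = int 1] (mod int p)" by (simp add: cong_iff_dvd_diff)
    then have "[q ^ h = 1] (mod p)" by (simp only: cong_int_iff)
    then show ?thesis using ord_minimal[of h p q] h by simp
  next
    case 2
    then have "int p dvd int (q ^ h + 1)" by (simp add: add.commute)
    then have "p dvd q ^ h + 1" by (simp only: of_nat_dvd_iff)
    then show ?thesis by (simp add: cong_0_iff h_def)
  qed
qed

theorem theorem7p2:
  fixes p q r b n :: nat and Y :: complex
  assumes "prime p" and "prime q" and "p \<noteq> q"
    and "r > 0" and "coprime r (p * q)"
    and "b > 0" and "n = q ^ b"
    and "Y \<in> int_adjoin (zeta (p * r))"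
    and "Y * cnj Y = of_nat n"
    and "even (ord p q)"
    and "real p > max (3 powr (real n / 2)) (real (n ^ 2 + n + 1))"
  shows "\<exists>\<eta>. root_of_unity \<eta> \<and> Y * \<eta> \<in> int_adjoin (zeta r)"
proof -
  have p0: "p > 0" and N0: "p * r > 0" using assms(1,4) prime_gt_0_nat by auto
  have pr: "coprime p r" and qr: "coprime q r" using assms(5) by (auto simp: coprime_commute)
  have qp: "coprime q p" using assms(1-3) primes_coprime by blast
  have qN: "coprime q (p * r)" using qp qr by simp
  note ctx = assms(1,4) pr
  have "real (n ^ 2 + n + 1) < real p" using assms(11) by simp
  then have large: "n ^ 2 + n + 1 < p" by (simp only: of_nat_less_iff)
  have powr: "3 powr (real n / 2) < real p" using assms(11) by simp
  have "q ^ 1 \<le> q ^ b" using prime_gt_0_nat[OF assms(2)] assms(6) by (intro power_increasing) auto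
  then have n2: "n \<ge> 2" using assms(7) prime_ge_2_nat[OF assms(2)] by simp
  have "n ^ 2 \<ge> 2 ^ 2" using n2 by (intro power_mono) auto
  then have p6: "p > 6" using large n2 by simp
  have podd: "odd p" using prime_odd_nat[OF assms(1)] p6 by simp
  define h where "h = ord p q div 2"
  define k where "k = q ^ h"
  have k: "coprime k (p * r)" "[k + 1 = 0] (mod p)"
    using qN power_half_order[OF assms(1) qp assms(10)] by (simp_all add: k_def h_def)
  have YY: "Y * cnj Y = of_nat (q ^ b)" using assms(7,9) by simp
  obtain \<epsilon> where eps: "\<epsilon> \<in> int_adjoin (zeta (p * r))" "\<epsilon> * cnj \<epsilon> = 1" "gal (p * r) k Y = \<epsilon> * Y"
    using frobenius_conjugate_multiple[OF N0 assms(2) qN assms(8) YY, of h] unfolding k_def by blast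
  obtain e where e: "\<And>i. e i \<in> int_adjoin (zeta r)" "\<epsilon> = (\<Sum>i<p. e i * zeta p ^ i)"
    "card {i. i < p \<and> e i \<noteq> 0} \<le> 1"
    using sparse_expansion[OF ctx eps(1), of 1] eps(2) p6 by auto
  obtain c where c: "c < p" "\<epsilon> = e c * zeta p ^ c"
    using monomial_if_card_le_1[OF ctx e(2,3)] by blast
  obtain y where y: "\<And>i. y i \<in> int_adjoin (zeta r)" "Y = (\<Sum>i<p. y i * zeta p ^ i)"
    "card {i. i < p \<and> y i \<noteq> 0} \<le> n"
    using sparse_expansion[OF ctx assms(8,9) large] by blast
  define S where "S = {i. i < p \<and> y i \<noteq> 0}"
  have S: "finite S" "card S \<le> n" using y(3) by (auto simp: S_def)
  have small2: "2 * card {i. i < p \<and> y i \<noteq> 0} < p"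
  proof -
    have "2 * n \<le> n ^ 2" using n2 by (simp add: power2_eq_square)
    then show ?thesis using y(3) large by linarith
  qed
  have refl: "(2 * p - i - c) mod p \<in> S" if "i \<in> S" for i
    using support_reflection[OF ctx k y(1,2) small2, of "e c" c i] e(1) c eps(3) that p0
    by (simp add: S_def)
  have "card S \<le> 1"
  proof -
    obtain cr :: "int \<Rightarrow> int" where cr: "\<And>x. [cr x = x] (mod int p)" "\<And>x. 2 * \<bar>cr x\<bar> < int p"
      using centered_residue[OF podd] by blast
    \<comment> \<open>The support is invariant under i -> -i - c. Shifting by half of c modulo
      \<open>p\<close> turns this reflection into x -> -x.\<close>
    obtain w where w: "[2 * w = c] (mod p)"
    proof -
      have "coprime 2 p" using podd by simp
      then obtain v where "[2 * v = 1] (mod p)" using cong_solve_coprime_nat[of 2 p] by auto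
      then have "[2 * v * c = 1 * c] (mod p)" by (intro cong_mult cong_refl)
      then show ?thesis using that[of "v * c"] by (simp add: mult.assoc)
    qed
    define \<phi> where "\<phi> = (\<lambda>i. cr (int i + int w))"
    define T where "T = \<phi> ` S"
    have \<phi>: "[\<phi> i = int i + int w] (mod int p)" "2 * \<bar>\<phi> i\<bar> < int p" for i
      using cr by (simp_all add: \<phi>_def)
    have \<phi>_inj: "i = j" if "\<phi> i = \<phi> j" "i \<in> S" "j \<in> S" for i j
    proof -
      have "[int i + int w = int j + int w] (mod int p)"
        using \<phi>(1)[of i] \<phi>(1)[of j] that(1) by (metis cong_sym cong_trans)
      then have "[i = j] (mod p)" by (simp add: cong_add_rcancel cong_int_iff)
      then show ?thesis using that by (simp add: S_def cong_def)
    qed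
    have cT: "card T = card S" unfolding T_def using \<phi>_inj by (intro card_image inj_onI) auto
    have finT: "finite T" using S by (simp add: T_def)
    have T_sym: "- x \<in> T" if xT: "x \<in> T" for x
    proof -
      obtain i where i: "i \<in> S" "x = \<phi> i" using xT by (auto simp: T_def)
      define i' where "i' = (2 * p - i - c) mod p"
      have "i + c \<le> 2 * p" using i(1) c(1) by (simp add: S_def)
      then have "int (2 * p - i - c) = 2 * int p - int i - int c" by simp
      then have "[int i' = 2 * int p - int i - int c] (mod int p)"
        by (simp add: i'_def zmod_int cong_def)
      moreover have "[2 * int w = int c] (mod int p)" using w by (metis cong_int_iff of_nat_mult of_nat_numeral)
      ultimately have "int p dvd (int i' - (2 * int p - int i - int c)) + (2 * int w - int c) + 2 * int p"
        by (intro dvd_add) (simp_all add: cong_iff_dvd_diff)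
      then have "int p dvd (int i' + int w) - - (int i + int w)" by (simp add: algebra_simps)
      then have "[int i' + int w = - (int i + int w)] (mod int p)" by (simp add: cong_iff_dvd_diff)
      moreover have "[- (int i + int w) = - \<phi> i] (mod int p)" 
        by (intro cong_uminus cong_sym[OF \<phi>(1)])
      ultimately have "[\<phi> i' = - \<phi> i] (mod int p)" using \<phi>(1)[of i'] cong_trans by blast
      then have "\<phi> i' = - \<phi> i" using \<phi>(2)[of i] \<phi>(2)[of i'] by (intro centered_residue_unique) auto
      then show ?thesis using refl[OF i(1)] i(2) unfolding T_def i'_def by (metis image_eqI)
    qed
    have "T \<subseteq> {0}"
    proof (rule ccontr)
      assume "\<not> T \<subseteq> {0}"
      then have nz: "\<exists>x\<in>T. x \<noteq> 0" by blast
      have "2 * card {x\<in>T. x > 0} \<le> n"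
        using two_card_positive_le[of T] finT T_sym S cT by fastforce
      then have "real (card {x\<in>T. x > 0}) \<le> real n / 2" by linarith
      then have "3 powr real (card {x\<in>T. x > 0}) \<le> 3 powr (real n / 2)" by (intro powr_mono) auto
      then have "3 powr real (card {x\<in>T. x > 0}) < real p" using powr by (rule le_less_trans)
      then have p3: "3 ^ card {x\<in>T. x > 0} < p" by (simp add: powr_realpow)
      have T_range: "2 * \<bar>x\<bar> < int p" if "x \<in> T" for x using that \<phi>(2) by (auto simp: T_def)
      obtain x where x: "x \<in> T" "x \<noteq> 0"
        and uniq: "\<And>y z. y \<in> T \<Longrightarrow> z \<in> T \<Longrightarrow> [y + z = 2 * x] (mod int p) \<Longrightarrow> y = x \<and> z = x"
        using symmetric_set_unique_double[OF assms(1) p3 finT T_sym T_range nz] by blast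
      \<comment> \<open>The positions \<open>i0\<close> and \<open>j0\<close> of x and -x have
        difference 2 x. Uniqueness of the double leaves no other such pair, so the correlation at 2
        x is the single product of two nonzero numbers.\<close>
      obtain i0 where i0: "i0 \<in> S" "x = \<phi> i0" using x by (auto simp: T_def)
      obtain j0 where j0: "j0 \<in> S" "- x = \<phi> j0" using T_sym[OF x(1)] by (auto simp: T_def)
      define l where "l = nat ((2 * x) mod int p)"
      have l_int: "int l = (2 * x) mod int p" using p0 by (simp add: l_def)
      have iff: "(i + (p - j)) mod p = l \<longleftrightarrow> [\<phi> i + - \<phi> j = 2 * x] (mod int p)" if "j < p" for i j
      proof -
        have "[\<phi> i + - \<phi> j = (int i + int w) + - (int j + int w)] (mod int p)"
          using \<phi>(1) by (intro cong_add cong_uminus)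
        then have d: "[\<phi> i + - \<phi> j = int i - int j] (mod int p)" by simp
        have "int (i + (p - j)) = int i - int j + int p" using that by simp
        then have "int ((i + (p - j)) mod p) = (int i - int j) mod int p"
          by (simp only: zmod_int mod_add_self2)
        then have "(i + (p - j)) mod p = l \<longleftrightarrow> [int i - int j = 2 * x] (mod int p)"
          unfolding cong_def using l_int by (metis of_nat_eq_iff)
        then show ?thesis using d by (metis cong_sym cong_trans)
      qed
      have lp: "l < p" using l_int p0 by (metis of_nat_less_iff pos_mod_bound of_nat_0_less_iff)
      have "\<not> [2 * x = 0] (mod int p)"
      proof
        assume "[2 * x = 0] (mod int p)"
        then have "int p dvd 2 * x" by (simp add: cong_0_iff)
        then have "int p \<le> \<bar>2 * x\<bar>" using x(2) dvd_imp_le_int[of "2 * x" "int p"] by simp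
        then show False using T_range[OF x(1)] by (simp add: abs_mult)
      qed
      then have l0: "l > 0" using l_int by (metis cong_0_iff dvd_eq_mod_eq_0 gr0I of_nat_0)
      have set: "{(i, j). i < p \<and> j < p \<and> y i \<noteq> 0 \<and> y j \<noteq> 0 \<and> (i + (p - j)) mod p = l} = {(i0, j0)}"
      proof (intro equalityI subsetI)
        fix ij assume "ij \<in> {(i, j). i < p \<and> j < p \<and> y i \<noteq> 0 \<and> y j \<noteq> 0 \<and> (i + (p - j)) mod p = l}"
        then obtain i j where ij: "ij = (i, j)" "i \<in> S" "j \<in> S" "(i + (p - j)) mod p = l"
          by (auto simp: S_def)
        have "[\<phi> i + - \<phi> j = 2 * x] (mod int p)" using iff[of j i] ij by (simp add: S_def)
        then have "\<phi> i = x \<and> - \<phi> j = x" using uniq[of "\<phi> i" "- \<phi> j"] T_sym ij by (auto simp: T_def)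
        then have "\<phi> i = \<phi> i0" "\<phi> j = \<phi> j0" using i0 j0 by auto
        then show "ij \<in> {(i0, j0)}" using \<phi>_inj ij i0 j0 by auto
      next
        fix ij assume "ij \<in> {(i0, j0)}"
        moreover have "(i0 + (p - j0)) mod p = l"
        proof -
          have "\<phi> i0 + - \<phi> j0 = 2 * x" using i0(2) j0(2) by simp
          moreover have "j0 < p" using j0(1) by (simp add: S_def)
          ultimately show ?thesis using iff[of j0 i0] by simp
        qed
        ultimately show "ij \<in> {(i, j). i < p \<and> j < p \<and> y i \<noteq> 0 \<and> y j \<noteq> 0 \<and> (i + (p - j)) mod p = l}"
          using i0 j0 by (simp add: S_def)
      qed
      have "(card S)\<^sup>2 \<le> n ^ 2" using S by (intro power_mono) auto
      then have "(card {i. i < p \<and> y i \<noteq> 0})\<^sup>2 + 1 < p"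
        using large n2 unfolding S_def by linarith
      from correlation_zero[OF ctx y(1,2) assms(9) this l0 lp]
      have "y i0 * cnj (y j0) = 0" by (simp add: set)
      then show False using i0 j0 by (simp add: S_def)
    qed
    then have "card T \<le> card {0::int}" by (intro card_mono) auto
    then show ?thesis using cT by simp
  qed
  then obtain i where i: "i < p" "Y = y i * zeta p ^ i"
    using monomial_if_card_le_1[OF ctx y(2)] by (auto simp: S_def)
  have "zeta p ^ i * zeta p ^ (p - i) = 1"
    using i zeta_power_self[OF p0] by (simp add: power_add[symmetric])
  then have "Y * zeta p ^ (p - i) = y i" by (simp add: i(2) mult.assoc)
  moreover have "root_of_unity (zeta p ^ (p - i))"
    unfolding root_of_unity_def using p0 zeta_power_self[OF p0]
    by (intro exI[of _ p]) (simp add: power_mult[symmetric] mult.commute[of "p - i"], simp add: power_mult)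
  ultimately show ?thesis using y(1)[of i] by metis
qed

end
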